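(* Let $m\geq0$, $r\geq2$ and $0\leq i\leq r-1$ be integers. Then \[ \sum_{s_1\geq\dots\geq s_{r}\geq-\lfloor m/2\rfloor}\frac{q^{s_1^2/2+s_2^2+\dots+s_{r}^2+m(s_1/2+s_2+\dots+s_{r-1})+s_1/2-(s_1+\dots+s_{i})}(-q^{m/2})_{s_1}(-q^{(m+1)/2})_{s_{r}}}{(q)_{s_1-s_2}\cdots(q)_{s_{r-1}-s_{r}}(-q^{(m+1)/2})_{s_{r-1}}}(-1)^{s_r}q^{-(m+1)s_r/2}\begin{bmatrix}m+s_r\\ m+2s_r\end{bmatrix}=d_m, \] where (the sum on the left running over integers $s_1,\dots,s_r$, and $s_1+\dots+s_i=0$ when $i=0$) for every integer $p\ge0$, \[ d_{2p}=\frac{(-q^p)_\infty}{2(q)_\infty}\sum_{k=0}^{2i}\sum_{\ell=0}^{2p}(-1)^\ell q^{pk+p\ell}(q^{2r-1},q^{2pr+r-i-2p+k+\ell-1/2},q^{r+i+2p-2pr-k-\ell-1/2};q^{2r-1})_\infty, \] \[ d_{2p+1}=(-1)^pq^{(3-2r)p^2/2+(1+i-r)p}\frac{(-q^{(2p+1)/2})_\infty}{(q)_\infty}\sum_{\ell=0}^{p}q^{\ell}(q^{2r-1},q^{2r-i-p+2\ell-3/2},q^{i+p-2\ell+1/2};q^{2r-1})_\infty. \]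
   Context: $q$ is a complex number with $|q|<1$ and $q^{1/2}$ is a fixed square root, with $q^{x/2}=(q^{1/2})^x$ for integers $x$. For complex $y$ and base $p'$ with $|p'|<1$, $(y;p')_\infty=\prod_{j\ge0}(1-yp'^j)$, $(y;p')_k=(y;p')_\infty/(yp'^k;p')_\infty$ for $k\in\mathbb{Z}$, $(y)_k=(y;q)_k$, $(y)_\infty=(y;q)_\infty$, and $(y_1,\dots,y_m;p')_\infty=\prod_i(y_i;p')_\infty$. For integers $N\ge0$ and $j$, $\begin{bmatrix}N\\ j\end{bmatrix}=\frac{(q)_N}{(q)_j(q)_{N-j}}$ if $0\le j\le N$ and $0$ otherwise.
   Formalization: The exponent term m(s_1/2+s_2+…+s_{r-1}) is corrected to m(s_1/2+s_2+…+s_r), since the printed identity fails (e.g. m=2, r=2, i=0 as q→0); the two agree for m≤1. Also q≠0 is assumed so that negative powers of q make sense. *)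

theory Defs
  imports "HOL-Analysis.Analysis"
begin

definition qpoch_inf :: "complex \<Rightarrow> complex \<Rightarrow> complex" where
  "qpoch_inf y b = (\<Prod>j. 1 - y * b ^ j)"

definition qpoch_infs :: "complex list \<Rightarrow> complex \<Rightarrow> complex" where
  "qpoch_infs ys b = prod_list (map (\<lambda>y. qpoch_inf y b) ys)"

definition qpoch :: "complex \<Rightarrow> complex \<Rightarrow> int \<Rightarrow> complex" where
  "qpoch y b k = qpoch_inf y b / qpoch_inf (y * b powi k) b"

definition qbinom :: "complex \<Rightarrow> int \<Rightarrow> int \<Rightarrow> complex" where
  "qbinom q N j =
     (if 0 \<le> j \<and> j \<le> N then qpoch q q N / (qpoch q q j * qpoch q q (N - j)) else 0)"

text \<open>
  Throughout, \<open>h\<close> is the fixed square root of \<open>q\<close>, and a power \<open>q\<^bsup>x/2\<^esup>\<close> is written \<open>h powi x\<close>,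
  so exponents of \<open>h\<close> are twice the usual exponents of \<open>q\<close>.
\<close>

definition index_set :: "nat \<Rightarrow> nat \<Rightarrow> (nat \<Rightarrow> int) set" where
  "index_set m r = {s \<in> {1..r} \<rightarrow>\<^sub>E UNIV.
     (\<forall>j\<in>{1..<r}. s (j + 1) \<le> s j) \<and> - int (m div 2) \<le> s r}"

text \<open>
  The exponent of \<open>q\<close> contains \<open>m (s\<^sub>1/2 + s\<^sub>2 + \<dots> + s\<^sub>r)\<close>, running up to \<open>s\<^sub>r\<close>. The source prints
  the last summand as \<open>s\<^bsub>r-1\<^esub>\<close>, which is a misprint: with it the identity fails for
  \<open>m = 2\<close>, \<open>r = 2\<close>, \<open>i = 0\<close>, where as \<open>q \<rightarrow> 0\<close> the series tends to \<open>1\<close> while \<open>d\<^sub>2\<close> is asymptotic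
  to \<open>- q\<^bsup>-1/2\<^esup> / 2\<close>. The two versions agree for \<open>m \<le> 1\<close>, where only \<open>s\<^sub>r = 0\<close> contributes.
\<close>

definition summand :: "complex \<Rightarrow> complex \<Rightarrow> nat \<Rightarrow> nat \<Rightarrow> nat \<Rightarrow> (nat \<Rightarrow> int) \<Rightarrow> complex" where
  "summand q h m r i s =
     h powi ((s 1)\<^sup>2 + 2 * (\<Sum>j=2..r. (s j)\<^sup>2)
             + int m * (s 1 + 2 * (\<Sum>j=2..r. s j))
             + s 1 - 2 * (\<Sum>j=1..i. s j))
     * qpoch (- (h ^ m)) q (s 1) * qpoch (- (h ^ (m + 1))) q (s r)
     / ((\<Prod>j=1..r-1. qpoch q q (s j - s (j + 1))) * qpoch (- (h ^ (m + 1))) q (s (r - 1)))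
     * (-1) powi (s r) * h powi (- (int m + 1) * s r)
     * qbinom q (int m + s r) (int m + 2 * s r)"

definition d_even :: "complex \<Rightarrow> complex \<Rightarrow> nat \<Rightarrow> nat \<Rightarrow> nat \<Rightarrow> complex" where
  "d_even q h r i p =
     qpoch_inf (- (q ^ p)) q / (2 * qpoch_inf q q) *
     (\<Sum>k=0..2*i. \<Sum>l=0..2*p. (-1) ^ l * q ^ (p * k + p * l) *
        qpoch_infs
          [q ^ (2 * r - 1),
           h powi (2 * (2 * int p * int r + int r - int i - 2 * int p + int k + int l) - 1),
           h powi (2 * (int r + int i + 2 * int p - 2 * int p * int r - int k - int l) - 1)]
          (q ^ (2 * r - 1)))"

definition d_odd :: "complex \<Rightarrow> complex \<Rightarrow> nat \<Rightarrow> nat \<Rightarrow> nat \<Rightarrow> complex" where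
  "d_odd q h r i p =
     (-1) ^ p * h powi ((3 - 2 * int r) * (int p)\<^sup>2 + 2 * (1 + int i - int r) * int p) *
     (qpoch_inf (- (h ^ (2 * p + 1))) q / qpoch_inf q q) *
     (\<Sum>l=0..p. q ^ l *
        qpoch_infs
          [q ^ (2 * r - 1),
           h powi (2 * (2 * int r - int i - int p + 2 * int l) - 3),
           h powi (2 * (int i + int p - 2 * int l) + 1)]
          (q ^ (2 * r - 1)))"

definition d :: "complex \<Rightarrow> complex \<Rightarrow> nat \<Rightarrow> nat \<Rightarrow> nat \<Rightarrow> complex" where
  "d q h r i m = (if even m then d_even q h r i (m div 2) else d_odd q h r i (m div 2))"

end

theory Submission
  imports Defs "HOL-Library.Nat_Bijection"
begin

text \<open>
  Put \<open>k\<^sub>\<rho>(n) = 1 / ((q)\<^bsub>n-\<rho>\<^esub> (q)\<^bsub>n+\<rho>+m\<^esub>)\<close> with \<open>1 / (q)\<^sub>j = 0\<close> for \<open>j < 0\<close>. By the \<open>q\<close>-binomial theorem the factor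
  depending on \<open>s\<^sub>r\<close> is a bilateral Bailey pair \<open>\<Sum>\<^sub>\<rho> (-1)\<^sup>\<rho> q\<^bsup>\<rho>(\<rho>-1)/2\<^esup> k\<^sub>\<rho>(s\<^sub>r)\<close>. Summing over \<open>s\<^sub>r\<close>, then
  \<open>s\<^bsub>r-1\<^esub>\<close>, and so on, multiplies the coefficients by powers of \<open>q\<close> (\<open>q\<close>-Chu--Vandermonde); at \<open>s\<^sub>i\<close> the
  parameter of the Bailey pair drops from \<open>q\<^sup>m\<close> to \<open>q\<^bsup>m-1\<^esup>\<close>. The final sum over \<open>s\<^sub>1\<close> gives, with
  \<open>u = q\<^bsup>\<rho>+m/2\<^esup>\<close>,
  \<open>(-q\<^bsup>m/2\<^esup>)\<^sub>\<infinity> / (q)\<^sub>\<infinity> \<Sum>\<^sub>\<rho> (-1)\<^sup>\<rho> q\<^bsup>(r-1/2)\<rho>\<^sup>2+((r-1)m-i)\<rho>\<^esup> (1 + u + \<dots> + u\<^bsup>2i\<^esup>) / (1 + u)\<close>.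
  Averaging with the image under \<open>\<rho> \<mapsto> -m-\<rho>\<close> turns the quotient by \<open>1 + u\<close> into a polynomial in \<open>u\<close>,
  and the Jacobi triple product evaluates each resulting theta series.
\<close>

section \<open>Infinite q-Pochhammer symbols\<close>

text \<open>Everything is done for one kernel at a time. For fixed \<rho> the kernel is an
  eigenvector of the operator that sends f to the sum over y of q^(y^2+my) f(y) / (q)_(x-y), so an
  inner summation acts diagonally on the coefficients and involves only finite sums; the single
  interchange of infinite sums is the one between s_1 and \<rho>. The lower limit -floor(m/2) cuts
  nothing off: the subscripts n-\<rho> and n+\<rho>+m add up to 2n+m, so every kernel vanishes once
  2n < -m. The quotient by 1+u comes from a mismatch of half a power of q. Summation over s_1 would
  be clean with (-q^((m+1)/2))_(s_1); with (-q^(m/2))_(s_1) one factor of an infinite product is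
  left over. Adding the reflected series yields 2S. For even m this is the 1/2 in d_m. For odd m the
  exponent 2\<rho>+m is odd, so u is never 1; the double geometric sum then collapses to
  (1-u^(2i+1)) times a sum of even powers, and its two halves are exchanged by the same reflection.
  This cancels the 2 and leaves a single sum.\<close>

lemma convergent_prod_qpoch:
  fixes y b :: complex
  assumes "norm b < 1"
  shows "convergent_prod (\<lambda>j. 1 - y * b ^ j)"
proof (rule abs_convergent_prod_imp_convergent_prod, rule summable_imp_abs_convergent_prod)
  show "summable (\<lambda>i. norm (1 - y * b ^ i - 1))"
    using assms by (simp add: norm_mult norm_power summable_mult)
qed

lemma qpoch_inf_rec:
  assumes "norm b < 1"
  shows "qpoch_inf y b = (1 - y) * qpoch_inf (y * b) b"
proof (cases "y = 1")
  \<comment> \<open>The head of an infinite product can be split off only if it is nonzero; at y = 1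
    both sides are 0.\<close>
  case True
  then have "(\<lambda>j. 1 - y * b ^ j) has_prod 0"
    using has_prod_zeroI[of "\<lambda>j. 1 - y * b ^ j" _ 0] convergent_prod_has_prod[OF convergent_prod_qpoch[OF assms, of y]]
    by (metis diff_self mult_1 power_0 has_prod_eq_0_iff)
  then show ?thesis
    using True has_prod_unique unfolding qpoch_inf_def by fastforce
next
  case False
  have "prodinf (\<lambda>j. 1 - y * b ^ j) = (1 - y) * (\<Prod>j. 1 - y * b ^ Suc j)"
    using prodinf_split_head[of "\<lambda>j. 1 - y * b ^ j"] convergent_prod_qpoch[OF assms, of y] False
    by (simp add: field_simps)
  then show ?thesis unfolding qpoch_inf_def by (simp add: mult_ac)
qed

lemma qpoch_inf_split:
  assumes "norm b < 1"
  shows "qpoch_inf y b = (\<Prod>i<n. 1 - y * b ^ i) * qpoch_inf (y * b ^ n) b"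
proof (induction n)
  case (Suc n)
  then show ?case
    using qpoch_inf_rec[OF assms, of "y * b ^ n"] by (simp add: mult_ac)
qed simp

lemma qpoch_inf_LIMSEQ:
  assumes "norm b < 1"
  shows "(\<lambda>n. \<Prod>i<n. 1 - y * b ^ i) \<longlonglongrightarrow> qpoch_inf y b"
  using convergent_prod_LIMSEQ[OF convergent_prod_qpoch[OF assms, of y]]
  unfolding qpoch_inf_def by (subst (asm) LIMSEQ_lessThan_iff_atMost[symmetric])

lemma qpoch_inf_nonzero:
  assumes "norm b < 1" and "\<And>j. y * b ^ j \<noteq> 1"
  shows "qpoch_inf y b \<noteq> 0"
  unfolding qpoch_inf_def
  by (rule prodinf_nonzero[OF convergent_prod_qpoch[OF assms(1)]]) (use assms(2) in simp)

text \<open>The tail is the full product divided by a partial product, and nonvanishing of the full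
  product makes the quotient tend to 1.\<close>

lemma qpoch_inf_tail_LIMSEQ:
  assumes "norm b < 1" and "\<And>j. y * b ^ j \<noteq> 1"
  shows "(\<lambda>n. qpoch_inf (y * b ^ n) b) \<longlonglongrightarrow> 1"
proof -
  have nz: "qpoch_inf y b \<noteq> 0"
    using assms by (rule qpoch_inf_nonzero)
  have "(\<lambda>n. qpoch_inf y b / (\<Prod>i<n. 1 - y * b ^ i)) \<longlonglongrightarrow> qpoch_inf y b / qpoch_inf y b"
    by (intro tendsto_intros qpoch_inf_LIMSEQ nz assms)
  moreover have "qpoch_inf y b / (\<Prod>i<n. 1 - y * b ^ i) = qpoch_inf (y * b ^ n) b" for n
  proof -
    have "(\<Prod>i<n. 1 - y * b ^ i) \<noteq> 0"
      using nz qpoch_inf_split[OF assms(1), of y n] by auto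
    then show ?thesis
      using qpoch_inf_split[OF assms(1), of y n] by (simp add: field_simps)
  qed
  ultimately show ?thesis using nz by simp
qed

text \<open>Counting in half powers of \<open>q\<close> keeps all exponents integral. The setting is
  a locale because the triple product is needed again in base q^(2r-1), by interpretation at
  \<open>h ^ R\<close> and \<open>q ^ R\<close>.\<close>

locale nome =
  fixes h q :: complex
  assumes h_nonzero [simp]: "h \<noteq> 0" and norm_h: "norm h < 1" and q_eq: "q = h\<^sup>2"
begin

lemma q_nonzero [simp]: "q \<noteq> 0"
  by (simp add: q_eq)

lemma norm_q: "norm q < 1"
  using norm_h by (simp add: q_eq norm_power power_less_one_iff)

lemma powi_mult: "h powi a * h powi b = h powi (a + b)"
  by (simp add: power_int_add)

lemma q_powi: "q powi k = h powi (2 * k)"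
  using power_int_power[of h 2 k] by (simp add: q_eq)

lemma q_power: "q ^ n = h powi (2 * int n)"
  using q_powi[of "int n"] by simp

section \<open>Nonvanishing and bounds for the factors of the summand\<close>

lemma norm_powi_eq_1_iff: "norm (h powi k) = 1 \<longleftrightarrow> k = 0"
proof
  assume "norm (h powi k) = 1"
  then have *: "norm h powi k = 1" by (simp add: norm_power_int)
  show "k = 0"
  proof (rule ccontr)
    assume "k \<noteq> 0"
    then consider "k > 0" | "k < 0" by linarith
    then show False
    proof cases
      case 1
      then have "norm h powi k < norm h powi 0"
        by (intro power_int_strict_decreasing) (use norm_h in auto)
      then show False using * by simp
    next
      case 2
      then have "norm h powi 0 < norm h powi k"
        by (intro power_int_strict_decreasing) (use norm_h in auto)
      then show False using * by simp
    qed
  qed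
qed simp

lemma powi_eq_1_iff [simp]: "h powi k = 1 \<longleftrightarrow> k = 0"
  using norm_powi_eq_1_iff[of k] by auto

text \<open>Modulus 1 occurs only at exponent 0, where the value is 1 and not -1. Hence no symbol
  (-q^(x/2))_s has a zero numerator or denominator, for negative s either.\<close>

lemma one_plus_powi_nonzero [simp]: "1 + h powi k \<noteq> 0"
proof
  assume *: "1 + h powi k = 0"
  then have "h powi k = - 1" by (simp add: eq_neg_iff_add_eq_0 add.commute)
  then have "norm (h powi k) = 1" by simp
  then have "k = 0" by (simp add: norm_powi_eq_1_iff)
  then show False using * by simp
qed

lemma neg_powi_neq_1 [simp]: "- (h powi k) \<noteq> 1"
  using one_plus_powi_nonzero[of k] by (metis add.right_inverse minus_minus)

lemma qpoch_inf_neg_powi_nonzero [simp]: "qpoch_inf (- (h powi k)) q \<noteq> 0"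
proof (rule qpoch_inf_nonzero[OF norm_q])
  show "- (h powi k) * q ^ j \<noteq> 1" for j
    by (simp add: q_power powi_mult)
qed

lemma qpoch_neg_powi:
  "qpoch (- (h powi \<nu>)) q s = qpoch_inf (- (h powi \<nu>)) q / qpoch_inf (- (h powi (\<nu> + 2 * s))) q"
  by (simp add: qpoch_def q_powi powi_mult)

lemma qpoch_neg_powi_nonzero [simp]: "qpoch (- (h powi \<nu>)) q s \<noteq> 0"
  by (simp add: qpoch_neg_powi)

lemma qpoch_neg_powi_add:
  "qpoch (- (h powi \<nu>)) q (s + int n) =
     qpoch (- (h powi \<nu>)) q s * (\<Prod>i<n. 1 + h powi (\<nu> + 2 * s + 2 * int i))"
proof -
  have "qpoch_inf (- (h powi (\<nu> + 2 * s))) q =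
      (\<Prod>i<n. 1 + h powi (\<nu> + 2 * s + 2 * int i)) * qpoch_inf (- (h powi (\<nu> + 2 * (s + int n)))) q"
    using qpoch_inf_split[OF norm_q, of "- (h powi (\<nu> + 2 * s))" n]
    by (simp add: q_power powi_mult algebra_simps)
  moreover from this have "(\<Prod>i<n. 1 + h powi (\<nu> + 2 * s + 2 * int i)) \<noteq> 0"
    by auto
  ultimately show ?thesis
    unfolding qpoch_neg_powi by (simp add: field_simps)
qed

text \<open>The reciprocal of \<open>(q)\<^sub>k\<close>, in a form that vanishes for \<open>k < 0\<close>.\<close>

definition iq :: "int \<Rightarrow> complex" where
  "iq k = qpoch_inf (q powi (k + 1)) q / qpoch_inf q q"

lemma q_power_Suc_neq_1: "q * q ^ j \<noteq> 1"
proof -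
  have "h powi (2 + 2 * int j) \<noteq> 1" by simp
  then show ?thesis
    using q_power[of "Suc j"] by (simp add: algebra_simps)
qed

lemma qpoch_inf_q_nonzero [simp]: "qpoch_inf q q \<noteq> 0"
  by (rule qpoch_inf_nonzero[OF norm_q q_power_Suc_neq_1])

text \<open>Valid for every integer k. At k = 0 the factor 1 - q^k is 0, which is how the vanishing
  at negative arguments starts.\<close>

lemma iq_rec: "iq (k - 1) = (1 - h powi (2 * k)) * iq k"
  using qpoch_inf_rec[OF norm_q, of "q powi k"]
  by (simp add: iq_def q_powi[symmetric] power_int_add)

lemma iq_0 [simp]: "iq 0 = 1"
  by (simp add: iq_def)

lemma iq_neg [simp]: "k < 0 \<Longrightarrow> iq k = 0"
proof (induction "nat (- k)" arbitrary: k)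
  case (Suc n)
  show ?case
  proof (cases "k = -1")
    case True
    then show ?thesis using iq_rec[of 0] by simp
  next
    case False
    then have "iq (k + 1) = 0" using Suc by (intro Suc.hyps(1)) auto
    then show ?thesis using iq_rec[of "k + 1"] by simp
  qed
qed simp

lemma iq_nonzero: "k \<ge> 0 \<Longrightarrow> iq k \<noteq> 0"
proof (induction k rule: int_ge_induct)
  case (step k)
  then show ?case using iq_rec[of "k + 1"] by auto
qed simp

text \<open>For k < 0 the denominator inside \<open>qpoch q q k\<close> is 0, so division by zero
  yields 0 and its inverse is again 0, in agreement with \<open>iq k\<close>. No sign condition on k
  is therefore required.\<close>

lemma inverse_qpoch_q: "inverse (qpoch q q k) = iq k"
  by (simp add: qpoch_def iq_def power_int_add mult.commute)

lemma iq_LIMSEQ: "(\<lambda>n. iq (int n + k)) \<longlonglongrightarrow> 1 / qpoch_inf q q"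
proof -
  \<comment> \<open>Shifting by |k| makes n + K + k a natural number, so that the tail limit
    applies; the shift is removed at the end.\<close>
  define K where "K = nat \<bar>k\<bar>"
  have "(\<lambda>n. qpoch_inf (q * q ^ n) q) \<longlonglongrightarrow> 1"
    by (rule qpoch_inf_tail_LIMSEQ[OF norm_q q_power_Suc_neq_1])
  then have "(\<lambda>n. qpoch_inf (q * q ^ (n + nat (int K + k))) q) \<longlonglongrightarrow> 1"
    by (rule LIMSEQ_ignore_initial_segment)
  then have "(\<lambda>n. qpoch_inf (q * q ^ (n + nat (int K + k))) q / qpoch_inf q q) \<longlonglongrightarrow> 1 / qpoch_inf q q"
    by (intro tendsto_intros) auto
  also have "(\<lambda>n. qpoch_inf (q * q ^ (n + nat (int K + k))) q / qpoch_inf q q) = (\<lambda>n. iq (int (n + K) + k))"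
  proof
    fix n
    have "q * q ^ (n + nat (int K + k)) = q powi (int (n + K) + k + 1)"
    proof -
      have "int (n + K) + k + 1 = int (Suc (n + nat (int K + k)))"
        by (simp add: K_def)
      then show ?thesis by (metis power_Suc power_int_of_nat)
    qed
    then show "qpoch_inf (q * q ^ (n + nat (int K + k))) q / qpoch_inf q q = iq (int (n + K) + k)"
      by (simp add: iq_def)
  qed
  finally show ?thesis by (rule LIMSEQ_offset)
qed

lemma iq_bounded: obtains B where "B > 0" and "\<And>k. norm (iq k) \<le> B"
proof -
  have "Bseq (\<lambda>n. iq (int n + 0))"
    using iq_LIMSEQ[of 0] by (intro convergent_imp_Bseq) (auto simp: convergent_def)
  then obtain B where B: "B > 0" "\<And>n. norm (iq (int n)) \<le> B"
    by (auto simp: Bseq_def)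
  have "norm (iq k) \<le> B" for k
    using B(2)[of "nat k"] B(1) by (cases "k < 0") auto
  then show ?thesis using B(1) that by blast
qed

text \<open>Along {L..} the symbol converges to a nonzero limit, so it is bounded and bounded away
  from 0. The second bound serves the factor (-q^((m+1)/2))_(s_(r-1)), which stands in the
  denominator.\<close>

lemma qpoch_neg_powi_bounded:
  obtains B where "B > 0" and "\<And>s. s \<ge> L \<Longrightarrow> norm (qpoch (- (h powi \<nu>)) q s) \<le> B"
    and "\<And>s. s \<ge> L \<Longrightarrow> norm (inverse (qpoch (- (h powi \<nu>)) q s)) \<le> B"
proof -
  define f where "f n = qpoch (- (h powi \<nu>)) q (L + int n)" for n
  have "(\<lambda>n. qpoch_inf (- (h powi (\<nu> + 2 * L)) * q ^ n) q) \<longlonglongrightarrow> 1"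
  proof (rule qpoch_inf_tail_LIMSEQ[OF norm_q])
    show "- (h powi (\<nu> + 2 * L)) * q ^ j \<noteq> 1" for j
      by (simp add: q_power powi_mult)
  qed
  then have *: "(\<lambda>n. qpoch_inf (- (h powi (\<nu> + 2 * (L + int n)))) q) \<longlonglongrightarrow> 1"
    by (simp add: q_power powi_mult algebra_simps)
  have lim: "f \<longlonglongrightarrow> qpoch_inf (- (h powi \<nu>)) q / 1"
    unfolding f_def qpoch_neg_powi by (intro tendsto_intros *) auto
  have "Bseq f"
    using lim by (intro convergent_imp_Bseq) (auto simp: convergent_def)
  then obtain B1 where B1: "B1 > 0" "\<And>n. norm (f n) \<le> B1"
    by (auto simp: Bseq_def)
  have "(\<lambda>n. inverse (f n)) \<longlonglongrightarrow> inverse (qpoch_inf (- (h powi \<nu>)) q / 1)"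
    by (intro tendsto_intros lim) auto
  then have "Bseq (\<lambda>n. inverse (f n))"
    by (intro convergent_imp_Bseq) (auto simp: convergent_def)
  then obtain B2 where B2: "B2 > 0" "\<And>n. norm (inverse (f n)) \<le> B2"
    by (auto simp: Bseq_def)
  show ?thesis
  proof (rule that[of "max B1 B2"])
    fix s assume "s \<ge> L"
    then have s: "s = L + int (nat (s - L))" by simp
    show "norm (qpoch (- (h powi \<nu>)) q s) \<le> max B1 B2"
      using B1(2)[of "nat (s - L)"] s unfolding f_def by (metis le_max_iff_disj)
    show "norm (inverse (qpoch (- (h powi \<nu>)) q s)) \<le> max B1 B2"
      using B2(2)[of "nat (s - L)"] s unfolding f_def by (metis le_max_iff_disj)
  qed (use B1 in auto)
qed

end

section \<open>The q-Chu--Vandermonde sum and the q-binomial theorem\<close>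

context nome
begin

text \<open>This is the sum of 2phi1(1/y, q^(-N); q^(c+1); y q^(N+c+1)) with the powers of y
  absorbed, so that y = 0 is a legitimate value, and with all shifted factorials written as
  reciprocals, so that c may be a negative integer.\<close>

lemma q_Chu_Vandermonde:
  "(\<Sum>t\<le>N. (\<Prod>i<t. h powi (2 * (c + 1 + int i)) * (h powi (2 * int i) - y)) *
      (iq (int N - int t) * iq (int t) * iq (int t + c)))
   = (\<Prod>i<N. 1 - y * h powi (2 * (c + 1 + int i))) * iq (int N) * iq (int N + c)"
proof (induction N arbitrary: c y)
  case 0
  show ?case by simp
next
  case (Suc N)
  define P where "P c y t = (\<Prod>i<t. h powi (2 * (c + 1 + int i)) * (h powi (2 * int i) - y))"
    for c :: int and y and t :: nat
  define E where "E N c y = (\<Sum>t\<le>N. P c y t * (iq (int N - int t) * iq (int t) * iq (int t + c)))"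
    for N c y
  define R where "R N c y = (\<Prod>i<N. 1 - y * h powi (2 * (c + 1 + int i)))"
    for N :: nat and c :: int and y
  have P_Suc: "P c y (Suc t) = h powi (2 * (c + 1 + int t)) * (1 - y) * P (c + 1) (y * h powi (- 2)) t"
    for t
  proof -
    have "P c y (Suc t) = h powi (2 * (c + 1)) * (1 - y) *
        (\<Prod>i<t. h powi (2 * (c + 1 + int (Suc i))) * (h powi (2 * int (Suc i)) - y))"
      unfolding P_def by (subst prod.lessThan_Suc_shift) simp
    also have "(\<Prod>i<t. h powi (2 * (c + 1 + int (Suc i))) * (h powi (2 * int (Suc i)) - y))
        = (\<Prod>i<t. h powi 2 * (h powi (2 * (c + 1 + 1 + int i)) * (h powi (2 * int i) - y * h powi (- 2))))"
    proof (rule prod.cong[OF refl])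
      fix i
      have "h powi (2 * int (Suc i)) - y = h powi 2 * (h powi (2 * int i) - y * h powi (- 2))"
        by (simp add: ring_distribs powi_mult mult.left_commute[of _ y] del: power_int_numeral power_int_numeral_neg_numeral)
      moreover have "2 * (c + 1 + int (Suc i)) = 2 * (c + 1 + 1 + int i)" by simp
      ultimately show "h powi (2 * (c + 1 + int (Suc i))) * (h powi (2 * int (Suc i)) - y) =
          h powi 2 * (h powi (2 * (c + 1 + 1 + int i)) * (h powi (2 * int i) - y * h powi (- 2)))"
        by (simp only: mult.left_commute)
    qed
    also have "\<dots> = h powi (2 * int t) * P (c + 1) (y * h powi (- 2)) t"
      unfolding P_def prod.distrib[of "\<lambda>_. h powi 2"]
      by (simp add: power_int_power' del: power_int_numeral power_int_numeral_neg_numeral)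
    finally show ?thesis
      by (simp add: powi_mult mult_ac) (simp add: algebra_simps)
  qed
  have rec: "(1 - h powi (2 * int (Suc N))) * E (Suc N) c y =
      E N c y + h powi (2 * (int (Suc N) + c)) * (1 - y) * E N (c + 1) (y * h powi (- 2))"
  proof -
    define T where "T t = P c y t * iq (int t + c)" for t
    \<comment> \<open>Uses 1 - q^(N+1) = (1 - q^(N+1-t)) + q^(N+1-t) (1 - q^t); each bracket lowers
      the argument of one \<open>iq\<close>. The first part is the sum for N, the second becomes the
      sum for N at (c+1, y/q) after t is shifted by one.\<close>
    have split: "(1 - h powi (2 * int (Suc N))) * (P c y t * (iq (int (Suc N) - int t) * iq (int t) * iq (int t + c)))
        = T t * (iq (int N - int t) * iq (int t))
          + T t * (h powi (2 * (int (Suc N) - int t)) * (iq (int (Suc N) - int t) * iq (int t - 1)))" for t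
    proof -
      have a: "iq (int N - int t) = (1 - h powi (2 * (int (Suc N) - int t))) * iq (int (Suc N) - int t)"
        using iq_rec[of "int (Suc N) - int t"] by simp
      have b: "iq (int t - 1) = (1 - h powi (2 * int t)) * iq (int t)"
        by (rule iq_rec)
      have "h powi (2 * int (Suc N)) = h powi (2 * (int (Suc N) - int t)) * h powi (2 * int t)"
        by (simp add: powi_mult)
      then show ?thesis
        unfolding a b T_def by (simp add: algebra_simps)
    qed
    have "(1 - h powi (2 * int (Suc N))) * E (Suc N) c y =
        (\<Sum>t\<le>Suc N. T t * (iq (int N - int t) * iq (int t))) +
        (\<Sum>t\<le>Suc N. T t * (h powi (2 * (int (Suc N) - int t)) * (iq (int (Suc N) - int t) * iq (int t - 1))))"
      unfolding E_def sum_distrib_left split sum.distrib ..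
    also have "(\<Sum>t\<le>Suc N. T t * (iq (int N - int t) * iq (int t))) = E N c y"
      unfolding E_def T_def by (simp add: mult_ac)
    also have "(\<Sum>t\<le>Suc N. T t * (h powi (2 * (int (Suc N) - int t)) * (iq (int (Suc N) - int t) * iq (int t - 1))))
        = (\<Sum>t\<le>N. T (Suc t) * (h powi (2 * (int N - int t)) * (iq (int N - int t) * iq (int t))))"
      by (subst sum.atMost_Suc_shift) simp
    also have "\<dots> = h powi (2 * (int (Suc N) + c)) * (1 - y) * E N (c + 1) (y * h powi (- 2))"
      unfolding E_def sum_distrib_left
    proof (rule sum.cong[OF refl])
      fix t
      have "2 * (c + 1 + int t) + 2 * (int N - int t) = 2 * (int (Suc N) + c)"
        by simp
      then have e: "h powi (2 * (int (Suc N) + c)) = h powi (2 * (c + 1 + int t)) * h powi (2 * (int N - int t))"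
        by (simp only: powi_mult)
      have "int (Suc t) + c = int t + (c + 1)" by simp
      then show "T (Suc t) * (h powi (2 * (int N - int t)) * (iq (int N - int t) * iq (int t))) =
        h powi (2 * (int (Suc N) + c)) * (1 - y) *
          (P (c + 1) (y * h powi (- 2)) t * (iq (int N - int t) * iq (int t) * iq (int t + (c + 1))))"
        unfolding T_def P_Suc e by (simp only: mult_ac)
    qed
    finally show ?thesis .
  qed
  have IH: "E N c y = R N c y * iq (int N) * iq (int N + c)" for c y
    unfolding E_def P_def R_def by (rule Suc.IH)
  have R1: "R N (c + 1) (y * h powi (- 2)) = R N c y"
  proof -
    have "y * h powi (- 2) * h powi (2 * (c + 1 + 1 + int i)) = y * h powi (2 * (c + 1 + int i))" for i
    proof -
      have "- 2 + 2 * (c + 1 + 1 + int i) = 2 * (c + 1 + int i)" by simp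
      then show ?thesis by (simp only: mult.assoc powi_mult)
    qed
    then show ?thesis unfolding R_def by (simp only:)
  qed
  have R2: "R (Suc N) c y = R N c y * (1 - y * h powi (2 * (int (Suc N) + c)))"
    unfolding R_def by (simp add: algebra_simps)
  have i1: "iq (int N + c) = (1 - h powi (2 * (int (Suc N) + c))) * iq (int (Suc N) + c)"
    using iq_rec[of "int (Suc N) + c"] by (simp add: algebra_simps)
  have i2: "iq (int N) = (1 - h powi (2 * int (Suc N))) * iq (int (Suc N))"
    using iq_rec[of "int (Suc N)"] by (simp add: algebra_simps)
  have i3: "int N + (c + 1) = int (Suc N) + c" by simp
  have alg: "r * (u * i) * ((1 - p) * j) + p * (1 - y) * (r * (u * i) * j) = u * (r * (1 - y * p) * i * j)"
    for r u i p j :: complex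
    by (simp add: algebra_simps)
  have "(1 - h powi (2 * int (Suc N))) * E (Suc N) c y =
     (1 - h powi (2 * int (Suc N))) * (R (Suc N) c y * iq (int (Suc N)) * iq (int (Suc N) + c))"
    unfolding rec IH R1 R2 i1 i2 i3 by (rule alg)
  moreover have "1 - h powi (2 * int (Suc N)) \<noteq> 0"
    using powi_eq_1_iff[of "2 * int (Suc N)"] by auto
  ultimately have "E (Suc N) c y = R (Suc N) c y * iq (int (Suc N)) * iq (int (Suc N) + c)"
    by (simp only: mult_cancel_left) simp
  then show ?case unfolding E_def P_def R_def .
qed

text \<open>The same splitting of 1 - q^(M+1) as for \<open>q_Chu_Vandermonde\<close>; here the
  shifted part reproduces the sum for M itself, multiplied by -z q^M.\<close>

lemma q_binomial_theorem:
  "(\<Sum>k\<le>M. (- 1) ^ k * h powi (int k * (int k - 1)) * z ^ k * (iq (int k) * iq (int M - int k)))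
   = (\<Prod>i<M. 1 - z * h powi (2 * int i)) * iq (int M)"
proof (induction M)
  case 0
  show ?case by simp
next
  case (Suc M)
  define E where "E M = (\<Sum>k\<le>M. (- 1) ^ k * h powi (int k * (int k - 1)) * z ^ k * (iq (int k) * iq (int M - int k)))"
    for M
  define T where "T k = (- 1) ^ k * h powi (int k * (int k - 1)) * z ^ k" for k
  have split: "(1 - h powi (2 * int (Suc M))) * (T k * (iq (int k) * iq (int (Suc M) - int k)))
      = T k * (iq (int k) * iq (int M - int k))
        + T k * (h powi (2 * (int (Suc M) - int k)) * (iq (int k - 1) * iq (int (Suc M) - int k)))" for k
  proof -
    have a: "iq (int M - int k) = (1 - h powi (2 * (int (Suc M) - int k))) * iq (int (Suc M) - int k)"
      using iq_rec[of "int (Suc M) - int k"] by simp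
    have b: "iq (int k - 1) = (1 - h powi (2 * int k)) * iq (int k)"
      by (rule iq_rec)
    have "h powi (2 * int (Suc M)) = h powi (2 * (int (Suc M) - int k)) * h powi (2 * int k)"
      by (simp add: powi_mult)
    then show ?thesis
      unfolding a b by (simp add: algebra_simps)
  qed
  have "(1 - h powi (2 * int (Suc M))) * E (Suc M) =
      (\<Sum>k\<le>Suc M. T k * (iq (int k) * iq (int M - int k))) +
      (\<Sum>k\<le>Suc M. T k * (h powi (2 * (int (Suc M) - int k)) * (iq (int k - 1) * iq (int (Suc M) - int k))))"
    unfolding E_def sum_distrib_left T_def[symmetric] split sum.distrib ..
  also have "(\<Sum>k\<le>Suc M. T k * (iq (int k) * iq (int M - int k))) = E M"
    unfolding E_def T_def by simp
  also have "(\<Sum>k\<le>Suc M. T k * (h powi (2 * (int (Suc M) - int k)) * (iq (int k - 1) * iq (int (Suc M) - int k))))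
      = (\<Sum>k\<le>M. T (Suc k) * (h powi (2 * (int M - int k)) * (iq (int k) * iq (int M - int k))))"
    by (subst sum.atMost_Suc_shift) simp
  also have "\<dots> = - z * h powi (2 * int M) * E M"
    unfolding E_def sum_distrib_left
  proof (rule sum.cong[OF refl])
    fix k
    have e: "int (Suc k) * (int (Suc k) - 1) + 2 * (int M - int k) = 2 * int M + int k * (int k - 1)"
      by (simp add: algebra_simps)
    have "h powi (int (Suc k) * (int (Suc k) - 1)) * h powi (2 * (int M - int k))
        = h powi (2 * int M) * h powi (int k * (int k - 1))"
      unfolding powi_mult e ..
    then have "- (((- 1) ^ k * z * z ^ k * (iq (int k) * iq (int M - int k))) *
          (h powi (int (Suc k) * (int (Suc k) - 1)) * h powi (2 * (int M - int k)))) =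
        - (((- 1) ^ k * z * z ^ k * (iq (int k) * iq (int M - int k))) *
          (h powi (2 * int M) * h powi (int k * (int k - 1))))"
      by (simp only:)
    then show "T (Suc k) * (h powi (2 * (int M - int k)) * (iq (int k) * iq (int M - int k))) =
        - z * h powi (2 * int M) * ((- 1) ^ k * h powi (int k * (int k - 1)) * z ^ k * (iq (int k) * iq (int M - int k)))"
      unfolding T_def power_Suc by (simp only: mult_ac mult_minus_left mult_minus_right mult_1)
  qed
  finally have "(1 - h powi (2 * int (Suc M))) * E (Suc M) = (1 - z * h powi (2 * int M)) * E M"
    by (simp add: algebra_simps)
  also have "E M = (\<Prod>i<M. 1 - z * h powi (2 * int i)) * iq (int M)"
    unfolding E_def by (rule Suc.IH)
  also have "iq (int M) = (1 - h powi (2 * int (Suc M))) * iq (int (Suc M))"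
    using iq_rec[of "int (Suc M)"] by (simp add: algebra_simps)
  finally have "(1 - h powi (2 * int (Suc M))) * E (Suc M) =
     (1 - h powi (2 * int (Suc M))) * ((\<Prod>i<Suc M. 1 - z * h powi (2 * int i)) * iq (int (Suc M)))"
    by (simp only: prod.lessThan_Suc mult_ac)
  moreover have "1 - h powi (2 * int (Suc M)) \<noteq> 0"
    using powi_eq_1_iff[of "2 * int (Suc M)"] by auto
  ultimately show ?case unfolding E_def by (simp only: mult_cancel_left) simp
qed

text \<open>A window of integers in place of an initial segment. The symmetric window A = B leads to
  the triple product, the window from -y-m to y at x = 1 to the unit Bailey pair.\<close>

lemma q_binomial_theorem_shifted:
  assumes "x \<noteq> 0" and "A + B \<ge> 0"
  shows "(\<Sum>\<rho>\<in>{-A..B}. (- 1) powi \<rho> * h powi (\<rho> * (\<rho> - 1)) * x powi \<rho> * (iq (B - \<rho>) * iq (A + \<rho>)))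
    = (- 1) powi A * x powi (- A) * h powi (A * (A + 1)) *
      ((\<Prod>i<nat (A + B). 1 - x * h powi (2 * (int i - A))) * iq (A + B))"
proof -
  define M where "M = nat (A + B)"
  have M: "int M = A + B" using assms by (simp add: M_def)
  have "(\<Sum>\<rho>\<in>{-A..B}. (- 1) powi \<rho> * h powi (\<rho> * (\<rho> - 1)) * x powi \<rho> * (iq (B - \<rho>) * iq (A + \<rho>)))
    = (\<Sum>k\<le>M. (- 1) powi A * x powi (- A) * h powi (A * (A + 1)) *
       ((- 1) ^ k * h powi (int k * (int k - 1)) * (x * h powi (- 2 * A)) ^ k * (iq (int k) * iq (int M - int k))))"
  proof (rule sum.reindex_bij_witness[of _ "\<lambda>k. int k - A" "\<lambda>\<rho>. nat (\<rho> + A)"])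
    fix \<rho> assume "\<rho> \<in> {-A..B}"
    define k where "k = nat (\<rho> + A)"
    have k: "\<rho> = int k - A" using \<open>\<rho> \<in> {-A..B}\<close> by (simp add: k_def)
    have 1: "(- 1) powi \<rho> = (- 1) powi A * (- 1 :: complex) ^ k"
      unfolding k by (simp add: power_int_diff power_int_minus_left)
    have 2: "x powi \<rho> = x powi (- A) * x ^ k"
      unfolding k using assms by (simp add: power_int_diff power_int_minus field_simps)
    have 3: "h powi (\<rho> * (\<rho> - 1)) = h powi (A * (A + 1)) * (h powi (int k * (int k - 1)) * (h powi (- 2 * A)) ^ k)"
    proof -
      have "\<rho> * (\<rho> - 1) = A * (A + 1) + (int k * (int k - 1) + - 2 * A * int k)"
        unfolding k by (simp add: algebra_simps)
      then show ?thesis by (simp only: powi_mult power_int_power')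
    qed
    have 4: "int M - int k = B - \<rho>" "int k = A + \<rho>" unfolding M k by simp_all
    show "(- 1) powi A * x powi (- A) * h powi (A * (A + 1)) *
       ((- 1) ^ nat (\<rho> + A) * h powi (int (nat (\<rho> + A)) * (int (nat (\<rho> + A)) - 1)) * (x * h powi (- 2 * A)) ^ nat (\<rho> + A) *
         (iq (int (nat (\<rho> + A))) * iq (int M - int (nat (\<rho> + A)))))
      = (- 1) powi \<rho> * h powi (\<rho> * (\<rho> - 1)) * x powi \<rho> * (iq (B - \<rho>) * iq (A + \<rho>))"
      unfolding k_def[symmetric] 1 2 3 4(1) 4(2)[symmetric] power_mult_distrib by (simp only: mult_ac)
  qed (use M in auto)
  also have "\<dots> = (- 1) powi A * x powi (- A) * h powi (A * (A + 1)) *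
      ((\<Prod>i<M. 1 - (x * h powi (- 2 * A)) * h powi (2 * int i)) * iq (int M))"
    by (simp only: sum_distrib_left[symmetric] q_binomial_theorem)
  also have "(\<Prod>i<M. 1 - (x * h powi (- 2 * A)) * h powi (2 * int i)) = (\<Prod>i<M. 1 - x * h powi (2 * (int i - A)))"
    by (simp add: mult.assoc powi_mult algebra_simps)
  finally show ?thesis unfolding M by (simp add: M_def)
qed

end

section \<open>Bailey kernels\<close>

context nome
begin

text \<open>The limit of \<open>q_Chu_Vandermonde\<close> for N to infinity, taken termwise by
  Tannery's theorem.\<close>

lemma q_Chu_Vandermonde_inf:
  "((\<lambda>t. (\<Prod>i<t. h powi (2 * (c + 1 + int i)) * (h powi (2 * int i) - y)) * (iq (int t) * iq (int t + c)))
     has_sum (qpoch_inf (y * h powi (2 * (c + 1))) q / qpoch_inf q q)) UNIV"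
proof -
  define P where "P t = (\<Prod>i<t. h powi (2 * (c + 1 + int i)) * (h powi (2 * int i) - y))" for t
  define a where "a k n = P k * (iq (int n - int k) * iq (int k) * iq (int k + c))" for k n
  define b where "b k = P k * (1 / qpoch_inf q q * iq (int k) * iq (int k + c))" for k
  obtain B where B: "B > 0" "\<And>k. norm (iq k) \<le> B"
    using iq_bounded by blast
  \<comment> \<open>These are the ratios of consecutive products \<open>P t\<close>. They tend to 0,
    which gives absolute summability and hence the dominating series.\<close>
  have lim0: "(\<lambda>t. h powi (2 * (c + 1 + int t)) * (h powi (2 * int t) - y)) \<longlonglongrightarrow> 0"
  proof -
    have "(\<lambda>t. h powi (2 * (c + 1)) * q ^ t * (q ^ t - y)) \<longlonglongrightarrow> h powi (2 * (c + 1)) * 0 * (0 - y)"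
      by (intro tendsto_intros LIMSEQ_power_zero norm_q)
    then show ?thesis by (simp add: q_power powi_mult algebra_simps)
  qed
  then have "\<forall>\<^sub>F t in sequentially. norm (h powi (2 * (c + 1 + int t)) * (h powi (2 * int t) - y)) < 1 / 2"
    by (metis (no_types, lifting) eventually_sequentially LIMSEQ_D diff_zero half_gt_zero zero_less_one)
  then obtain N where N: "\<And>t. t \<ge> N \<Longrightarrow> norm (h powi (2 * (c + 1 + int t)) * (h powi (2 * int t) - y)) < 1 / 2"
    by (auto simp: eventually_sequentially)
  have sumP: "summable (\<lambda>t. norm (P t))"
  proof (rule summable_ratio_test[of "1 / 2" N])
    fix t assume "t \<ge> N"
    then have "norm (P t) * norm (h powi (2 * (c + 1 + int t)) * (h powi (2 * int t) - y)) \<le> norm (P t) * (1 / 2)"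
      using N by (intro mult_left_mono) (auto intro: less_imp_le)
    then show "norm (norm (P (Suc t))) \<le> 1 / 2 * norm (norm (P t))"
      by (simp add: P_def norm_mult mult_ac)
  qed simp
  have T: "eventually (\<lambda>n. summable (\<lambda>k. norm (a k n))) sequentially \<and> summable (\<lambda>n. norm (b n)) \<and>
     (\<lambda>n. suminf (\<lambda>k. a k n)) \<longlonglongrightarrow> suminf b"
  proof (rule tannerys_theorem)
    show "(\<lambda>n. a k n) \<longlonglongrightarrow> b k" for k
      unfolding a_def b_def using iq_LIMSEQ[of "- int k"] by (intro tendsto_intros) auto
    have "norm (a k n) \<le> norm (P k) * (B * B * B)" for k n
      unfolding a_def norm_mult
      by (intro mult_left_mono mult_mono B) (use B in auto)
    then show "\<forall>\<^sub>F (k, n) in sequentially \<times>\<^sub>F sequentially. norm (a k n) \<le> norm (P k) * (B * B * B)"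
      by (intro always_eventually) auto
    show "summable (\<lambda>k. norm (P k) * (B * B * B))"
      by (intro summable_mult2 sumP)
  qed simp
  have "suminf (\<lambda>k. a k n) = (\<Prod>i<n. 1 - y * h powi (2 * (c + 1 + int i))) * iq (int n) * iq (int n + c)" for n
  proof -
    have "suminf (\<lambda>k. a k n) = (\<Sum>k\<le>n. a k n)"
      by (rule suminf_finite) (auto simp: a_def)
    then show ?thesis
      unfolding a_def P_def q_Chu_Vandermonde .
  qed
  moreover have "(\<lambda>n. (\<Prod>i<n. 1 - y * h powi (2 * (c + 1 + int i))) * iq (int n) * iq (int n + c))
      \<longlonglongrightarrow> qpoch_inf (y * h powi (2 * (c + 1))) q * (1 / qpoch_inf q q) * (1 / qpoch_inf q q)"
  proof (intro tendsto_mult)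
    show "(\<lambda>n. \<Prod>i<n. 1 - y * h powi (2 * (c + 1 + int i))) \<longlonglongrightarrow> qpoch_inf (y * h powi (2 * (c + 1))) q"
      using qpoch_inf_LIMSEQ[OF norm_q, of "y * h powi (2 * (c + 1))"]
      by (simp add: q_power powi_mult mult.assoc algebra_simps)
    show "(\<lambda>n. iq (int n)) \<longlonglongrightarrow> 1 / qpoch_inf q q"
      using iq_LIMSEQ[of 0] by simp
  qed (rule iq_LIMSEQ)
  ultimately have "(\<lambda>n. suminf (\<lambda>k. a k n)) \<longlonglongrightarrow>
      qpoch_inf (y * h powi (2 * (c + 1))) q * (1 / qpoch_inf q q) * (1 / qpoch_inf q q)"
    by (simp only:)
  then have "suminf b = qpoch_inf (y * h powi (2 * (c + 1))) q * (1 / qpoch_inf q q) * (1 / qpoch_inf q q)"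
    using T LIMSEQ_unique by blast
  then have "(b has_sum (qpoch_inf (y * h powi (2 * (c + 1))) q * (1 / qpoch_inf q q) * (1 / qpoch_inf q q))) UNIV"
    using T by (metis norm_summable_imp_has_sum summable_norm_cancel summable_sums)
  \<comment> \<open>Multiplying by (q)_inf removes the factor 1/(q)_inf to which
    \<open>iq (int n - int k)\<close> tends.\<close>
  then have "((\<lambda>k. qpoch_inf q q * b k) has_sum
      (qpoch_inf q q * (qpoch_inf (y * h powi (2 * (c + 1))) q * (1 / qpoch_inf q q) * (1 / qpoch_inf q q)))) UNIV"
    by (rule has_sum_cmult_right)
  then show ?thesis
    by (simp add: b_def P_def field_simps)
qed

section \<open>Kernels as eigenvectors of weighted summation\<close>

definition kern :: "int \<Rightarrow> int \<Rightarrow> int \<Rightarrow> complex" where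
  "kern \<mu> \<rho> x = iq (x - \<rho>) * iq (x + \<rho> + \<mu>)"

text \<open>The two arguments of \<open>iq\<close> in the kernel add up to 2x + \<mu>, so one of
  them is negative.\<close>

lemma kern_eq_0: "2 * x < - \<mu> \<Longrightarrow> kern \<mu> \<rho> x = 0"
  by (cases "x < \<rho>") (auto simp: kern_def)

lemma kern_eq_0': "\<rho> < - x - \<mu> \<or> x < \<rho> \<Longrightarrow> kern \<mu> \<rho> x = 0"
  by (auto simp: kern_def)

text \<open>With s = \<rho> + t the kernel becomes \<open>iq t * iq (t + c)\<close> for c = 2\<rho>
  + \<mu>, and both claims are q-Chu--Vandermonde sums. The condition on L says that the kernel
  vanishes below L, so starting at L instead of \<rho> changes nothing, whichever is larger.\<close>

lemma kern_transform:
  assumes W: "\<And>t. W (\<rho> + int t) =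
      K * (\<Prod>i<t. h powi (2 * (2 * \<rho> + \<mu> + 1 + int i)) * (h powi (2 * int i) - y))"
    and L: "2 * L \<le> 1 - \<mu>"
  shows "(\<Sum>x'\<in>{L..x}. iq (x - x') * W x' * kern \<mu> \<rho> x') =
      K * (\<Prod>i<nat (x - \<rho>). 1 - y * h powi (2 * (2 * \<rho> + \<mu> + 1 + int i))) * kern \<mu> \<rho> x"
    and "((\<lambda>s. W s * kern \<mu> \<rho> s) has_sum
      (K * (qpoch_inf (y * h powi (2 * (2 * \<rho> + \<mu> + 1))) q / qpoch_inf q q))) {L..}"
proof -
  define P where "P t = (\<Prod>i<t. h powi (2 * (2 * \<rho> + \<mu> + 1 + int i)) * (h powi (2 * int i) - y))" for t
  have k: "kern \<mu> \<rho> (\<rho> + int t) = iq (int t) * iq (int t + (2 * \<rho> + \<mu>))" for t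
    by (simp add: kern_def algebra_simps)
  have zero: "kern \<mu> \<rho> s = 0" if "s < L \<or> s < \<rho>" for s
    using that L kern_eq_0[of s \<mu> \<rho>] kern_eq_0'[of \<rho> s \<mu>] by auto
  show "(\<Sum>x'\<in>{L..x}. iq (x - x') * W x' * kern \<mu> \<rho> x') =
      K * (\<Prod>i<nat (x - \<rho>). 1 - y * h powi (2 * (2 * \<rho> + \<mu> + 1 + int i))) * kern \<mu> \<rho> x"
  proof (cases "\<rho> \<le> x")
    case True
    define N where "N = nat (x - \<rho>)"
    have N: "x = \<rho> + int N" using True by (simp add: N_def)
    have "(\<Sum>x'\<in>{L..x}. iq (x - x') * W x' * kern \<mu> \<rho> x') = (\<Sum>x'\<in>{\<rho>..x}. iq (x - x') * W x' * kern \<mu> \<rho> x')"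
      by (rule sum.mono_neutral_cong) (use zero in auto)
    also have "\<dots> = (\<Sum>t\<le>N. K * (P t * (iq (int N - int t) * iq (int t) * iq (int t + (2 * \<rho> + \<mu>)))))"
    proof (rule sum.reindex_bij_witness[of _ "\<lambda>t. \<rho> + int t" "\<lambda>s. nat (s - \<rho>)"])
      fix s assume "s \<in> {\<rho>..x}"
      define t where "t = nat (s - \<rho>)"
      have t: "s = \<rho> + int t" using \<open>s \<in> {\<rho>..x}\<close> by (simp add: t_def)
      show "K * (P (nat (s - \<rho>)) * (iq (int N - int (nat (s - \<rho>))) * iq (int (nat (s - \<rho>))) *
          iq (int (nat (s - \<rho>)) + (2 * \<rho> + \<mu>)))) = iq (x - s) * W s * kern \<mu> \<rho> s"
        unfolding t_def[symmetric] unfolding t k W P_def[symmetric] N by simp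
    qed (use N in auto)
    also have "\<dots> = K * ((\<Prod>i<N. 1 - y * h powi (2 * (2 * \<rho> + \<mu> + 1 + int i))) * iq (int N) * iq (int N + (2 * \<rho> + \<mu>)))"
      unfolding sum_distrib_left[symmetric] P_def q_Chu_Vandermonde ..
    finally show ?thesis
      by (simp add: N k)
  next
    case False
    then have "(\<Sum>x'\<in>{L..x}. iq (x - x') * W x' * kern \<mu> \<rho> x') = 0"
      by (intro sum.neutral) (use zero in auto)
    then show ?thesis using zero[of x] False by simp
  qed
  show "((\<lambda>s. W s * kern \<mu> \<rho> s) has_sum
      (K * (qpoch_inf (y * h powi (2 * (2 * \<rho> + \<mu> + 1))) q / qpoch_inf q q))) {L..}"
  proof -
    have "((\<lambda>t. K * (P t * (iq (int t) * iq (int t + (2 * \<rho> + \<mu>))))) has_sum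
      (K * (qpoch_inf (y * h powi (2 * (2 * \<rho> + \<mu> + 1))) q / qpoch_inf q q))) UNIV"
      unfolding P_def by (intro has_sum_cmult_right q_Chu_Vandermonde_inf)
    also have "(\<lambda>t. K * (P t * (iq (int t) * iq (int t + (2 * \<rho> + \<mu>))))) =
        (\<lambda>s. W s * kern \<mu> \<rho> s) \<circ> (\<lambda>t. \<rho> + int t)"
      by (auto simp: W k P_def)
    finally have "((\<lambda>s. W s * kern \<mu> \<rho> s) has_sum
      (K * (qpoch_inf (y * h powi (2 * (2 * \<rho> + \<mu> + 1))) q / qpoch_inf q q))) (range (\<lambda>t. \<rho> + int t))"
      by (subst has_sum_reindex) (auto simp: inj_on_def o_def)
    also have "range (\<lambda>t. \<rho> + int t) = {\<rho>..}"
      by (auto simp: image_iff intro!: exI[of _ "nat (_ - \<rho>)"])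
    finally show ?thesis
      by (subst has_sum_cong_neutral[of "{\<rho>..}" _ _ "\<lambda>s. W s * kern \<mu> \<rho> s"]) (use zero in auto)
  qed
qed

text \<open>The quadratic exponent is chosen so that consecutive weights have the ratio demanded by
  \<open>kern_transform\<close>. The value y = -q^(-\<nu>/2-\<rho>) arises from 1 + q^(\<nu>/2+s) =
  q^(\<nu>/2+\<rho>) (q^t - y) with s = \<rho> + t.\<close>

lemma kern_weight_qpoch:
  "h powi ((\<rho> + int t)\<^sup>2 + (2 * \<mu> + 1 - \<nu>) * (\<rho> + int t)) * qpoch (- (h powi \<nu>)) q (\<rho> + int t) =
   (h powi (\<rho>\<^sup>2 + (2 * \<mu> + 1 - \<nu>) * \<rho>) * qpoch (- (h powi \<nu>)) q \<rho>) *
   (\<Prod>i<t. h powi (2 * (2 * \<rho> + \<mu> + 1 + int i)) * (h powi (2 * int i) - (- (h powi (- \<nu> - 2 * \<rho>)))))"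
proof (induction t)
  case 0
  show ?case by simp
next
  case (Suc t)
  define s where "s = \<rho> + int t"
  have s: "\<rho> + int (Suc t) = s + int 1" by (simp add: s_def)
  have e1: "(s + int 1)\<^sup>2 + (2 * \<mu> + 1 - \<nu>) * (s + int 1) =
      (s\<^sup>2 + (2 * \<mu> + 1 - \<nu>) * s) + (2 * (2 * \<rho> + \<mu> + 1 + int t) + (- \<nu> - 2 * \<rho>))"
    by (simp add: s_def algebra_simps power2_eq_square)
  have e2: "\<nu> + 2 * s = 2 * int t - (- \<nu> - 2 * \<rho>)" by (simp add: s_def)
  have "h powi (2 * int t) - (- (h powi (- \<nu> - 2 * \<rho>))) = h powi (- \<nu> - 2 * \<rho>) * (1 + h powi (\<nu> + 2 * s))"
    unfolding e2 by (simp add: ring_distribs powi_mult)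
  then show ?case
    using Suc.IH unfolding s qpoch_neg_powi_add e1 powi_mult[symmetric] prod.lessThan_Suc s_def[symmetric]
    by (simp add: mult_ac)
qed

lemma kern_weight_powi:
  "h powi (2 * (\<rho> + int t)\<^sup>2 + 2 * \<mu> * (\<rho> + int t)) =
   h powi (2 * \<rho>\<^sup>2 + 2 * \<mu> * \<rho>) *
   (\<Prod>i<t. h powi (2 * (2 * \<rho> + \<mu> + 1 + int i)) * (h powi (2 * int i) - 0))"
proof (induction t)
  case 0
  show ?case by simp
next
  case (Suc t)
  have e: "2 * (\<rho> + int (Suc t))\<^sup>2 + 2 * \<mu> * (\<rho> + int (Suc t)) =
     (2 * (\<rho> + int t)\<^sup>2 + 2 * \<mu> * (\<rho> + int t)) + (2 * (2 * \<rho> + \<mu> + 1 + int t) + 2 * int t)"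
    by (simp add: algebra_simps power2_eq_square)
  have "h powi (2 * (\<rho> + int (Suc t))\<^sup>2 + 2 * \<mu> * (\<rho> + int (Suc t))) =
     h powi (2 * (\<rho> + int t)\<^sup>2 + 2 * \<mu> * (\<rho> + int t)) *
       (h powi (2 * (2 * \<rho> + \<mu> + 1 + int t)) * h powi (2 * int t))"
    by (simp only: e powi_mult)
  then show ?case
    unfolding Suc.IH prod.lessThan_Suc by (simp only: mult_ac diff_zero)
qed

text \<open>The case y = 0, in which the product on the right is 1 and the kernel is a genuine
  eigenvector.\<close>

lemma Bailey_step:
  assumes "2 * L \<le> 1 - \<mu>"
  shows "(\<Sum>y\<in>{L..x}. iq (x - y) * h powi (2 * y\<^sup>2 + 2 * \<mu> * y) * kern \<mu> \<rho> y) =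
     h powi (2 * \<rho>\<^sup>2 + 2 * \<mu> * \<rho>) * kern \<mu> \<rho> x"
  using kern_transform(1)[OF kern_weight_powi[of \<rho> _ \<mu>] assms, of x] by simp

text \<open>For \<nu> = \<mu> + 1 the product on the right is (-q^((\<mu>+1)/2+\<rho>))_(x-\<rho>),
  which combines with the symbol of index \<rho> to one of index x, free of \<rho>. The denominator
  (-q^((m+1)/2))_(s_(r-1)) of the summand exists to cancel it.\<close>

lemma Bailey_step_qpoch:
  assumes "2 * L \<le> 1 - \<mu>"
  shows "(\<Sum>y\<in>{L..x}. iq (x - y) * (h powi (y\<^sup>2 + \<mu> * y) * qpoch (- (h powi (\<mu> + 1))) q y) * kern \<mu> \<rho> y) =
     h powi (\<rho>\<^sup>2 + \<mu> * \<rho>) * qpoch (- (h powi (\<mu> + 1))) q x * kern \<mu> \<rho> x"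
proof (cases "\<rho> \<le> x")
  case True
  have w: "(2 * \<mu> + 1 - (\<mu> + 1)) = \<mu>" by simp
  have p: "1 - - (h powi (- (\<mu> + 1) - 2 * \<rho>)) * h powi (2 * (2 * \<rho> + \<mu> + 1 + int i)) =
      1 + h powi (\<mu> + 1 + 2 * \<rho> + 2 * int i)" for i
    by (simp add: powi_mult algebra_simps)
  have "qpoch (- (h powi (\<mu> + 1))) q x = qpoch (- (h powi (\<mu> + 1))) q (\<rho> + int (nat (x - \<rho>)))"
    using True by simp
  also have "\<dots> = qpoch (- (h powi (\<mu> + 1))) q \<rho> * (\<Prod>i<nat (x - \<rho>). 1 + h powi (\<mu> + 1 + 2 * \<rho> + 2 * int i))"
    by (rule qpoch_neg_powi_add)
  finally show ?thesis
    using kern_transform(1)[OF kern_weight_qpoch[of \<rho> _ \<mu> "\<mu> + 1"] assms, of x] unfolding w p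
    by (simp add: mult_ac)
next
  case False
  then have "(\<Sum>y\<in>{L..x}. iq (x - y) * (h powi (y\<^sup>2 + \<mu> * y) * qpoch (- (h powi (\<mu> + 1))) q y) * kern \<mu> \<rho> y) = 0"
    by (intro sum.neutral) (auto simp: kern_eq_0')
  then show ?thesis using False by (simp add: kern_eq_0')
qed

lemma Bailey_limit:
  assumes "2 * L \<le> 1 - \<mu>"
  shows "((\<lambda>s. h powi (s\<^sup>2 + \<mu> * s) * qpoch (- (h powi (\<mu> + 1))) q s * kern \<mu> \<rho> s) has_sum
     (qpoch_inf (- (h powi (\<mu> + 1))) q / qpoch_inf q q * h powi (\<rho>\<^sup>2 + \<mu> * \<rho>))) {L..}"
proof -
  have w: "(2 * \<mu> + 1 - (\<mu> + 1)) = \<mu>" by simp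
  have p: "- (h powi (- (\<mu> + 1) - 2 * \<rho>)) * h powi (2 * (2 * \<rho> + \<mu> + 1)) = - (h powi (\<mu> + 1 + 2 * \<rho>))"
    by (simp add: powi_mult algebra_simps)
  show ?thesis
    using kern_transform(2)[OF kern_weight_qpoch[of \<rho> _ \<mu> "\<mu> + 1"] assms] unfolding w p
    by (simp add: qpoch_neg_powi mult_ac)
qed

text \<open>Here \<nu> = \<mu> is one below the value \<mu> + 1 of \<open>Bailey_limit\<close>. The
  infinite products start at exponents \<mu>/2+\<rho>+1 and \<mu>/2+\<rho>, and their quotient
  leaves the denominator 1 + q^(\<mu>/2+\<rho>).\<close>

lemma Bailey_limit':
  assumes "2 * L \<le> 1 - \<mu>"
  shows "((\<lambda>s. h powi (s\<^sup>2 + (\<mu> + 1) * s) * qpoch (- (h powi \<mu>)) q s * kern \<mu> \<rho> s) has_sum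
     (qpoch_inf (- (h powi \<mu>)) q / qpoch_inf q q * (h powi (\<rho>\<^sup>2 + (\<mu> + 1) * \<rho>) / (1 + h powi (\<mu> + 2 * \<rho>))))) {L..}"
proof -
  have w: "(2 * \<mu> + 1 - \<mu>) = \<mu> + 1" by simp
  have p: "- (h powi (- \<mu> - 2 * \<rho>)) * h powi (2 * (2 * \<rho> + \<mu> + 1)) = - (h powi (\<mu> + 2 * \<rho> + 2))"
    by (simp add: powi_mult algebra_simps)
  have r: "qpoch_inf (- (h powi (\<mu> + 2 * \<rho>))) q = (1 + h powi (\<mu> + 2 * \<rho>)) * qpoch_inf (- (h powi (\<mu> + 2 * \<rho> + 2))) q"
    using qpoch_inf_rec[OF norm_q, of "- (h powi (\<mu> + 2 * \<rho>))"]
    by (simp add: power_int_add[of h _ 2] flip: q_eq)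
  have val: "h powi (\<rho>\<^sup>2 + (\<mu> + 1) * \<rho>) * qpoch (- (h powi \<mu>)) q \<rho> *
      (qpoch_inf (- (h powi (\<mu> + 2 * \<rho> + 2))) q / qpoch_inf q q) =
     qpoch_inf (- (h powi \<mu>)) q / qpoch_inf q q * (h powi (\<rho>\<^sup>2 + (\<mu> + 1) * \<rho>) / (1 + h powi (\<mu> + 2 * \<rho>)))"
    unfolding qpoch_neg_powi r by simp (simp add: mult.commute)
  show ?thesis
    using kern_transform(2)[OF kern_weight_qpoch[of \<rho> _ \<mu> \<mu>] assms] unfolding w p val .
qed

text \<open>Write q^(-y) = q^(-\<rho>) + q^(-y) (1 - q^(y-\<rho>)); the bracket lowers the first
  \<open>iq\<close> by one. Passing to (\<mu>-1, \<rho>+1) does exactly this, since it preserves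
  \<rho> + \<mu>.\<close>

lemma kern_shift:
  "h powi (- 2 * y) * kern \<mu> \<rho> y = h powi (- 2 * \<rho>) * kern \<mu> \<rho> y + h powi (- 2 * y) * kern (\<mu> - 1) (\<rho> + 1) y"
proof -
  have a: "iq (y - \<rho> - 1) = (1 - h powi (2 * (y - \<rho>))) * iq (y - \<rho>)"
    by (rule iq_rec)
  have b: "h powi (- 2 * \<rho>) = h powi (- 2 * y) * h powi (2 * (y - \<rho>))"
    by (simp add: powi_mult)
  have c: "kern (\<mu> - 1) (\<rho> + 1) y = iq (y - \<rho> - 1) * iq (y + \<rho> + \<mu>)"
    by (simp add: kern_def algebra_simps)
  have alg: "u * (i * j) = u * p * (i * j) + u * ((1 - p) * i * j)" for u p i j :: complex
    by (simp add: algebra_simps)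
  show ?thesis
    unfolding b c a unfolding kern_def by (rule alg)
qed

end

section \<open>The Jacobi triple product and the unit Bailey pair\<close>

lemma summable_on_intI:
  fixes f :: "int \<Rightarrow> real"
  assumes "\<And>n. f n \<ge> 0" and "summable (\<lambda>n. f (int n))" and "summable (\<lambda>n. f (- int n))"
  shows "f summable_on UNIV"
proof -
  have "(f \<circ> int) summable_on UNIV"
    using assms by (intro norm_summable_imp_summable_on) (simp add: o_def)
  then have 1: "f summable_on (range int)"
    by (subst summable_on_reindex) auto
  have "summable (\<lambda>n. f (- int (Suc n)))"
    using assms(3) summable_Suc_iff[of "\<lambda>n. f (- int n)"] by simp
  then have "(f \<circ> (\<lambda>n. - int (Suc n))) summable_on UNIV"
    using assms by (intro norm_summable_imp_summable_on) (simp add: o_def)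
  then have 2: "f summable_on (range (\<lambda>n. - int (Suc n)))"
    by (subst summable_on_reindex) (auto simp: inj_on_def)
  have "k \<in> range int \<union> range (\<lambda>n. - int (Suc n))" for k
    by (cases k rule: int_cases) auto
  then have "range int \<union> range (\<lambda>n. - int (Suc n)) = UNIV" by blast
  moreover have "range int \<inter> range (\<lambda>n. - int (Suc n)) = {}" by auto
  ultimately show ?thesis
    using summable_on_Un_disjoint[OF 1 2] by simp
qed

context nome
begin

text \<open>Consecutive terms have ratio h^(a(2n+1)) z, which tends to 0; the negative half is the
  positive half at 1/x.\<close>

lemma theta_summable:
  assumes "x \<noteq> 0" and "a > 0"
  shows "(\<lambda>\<rho>. norm (h powi (a * \<rho>\<^sup>2) * x powi \<rho>)) summable_on UNIV"
proof (rule summable_on_intI)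
  have *: "summable (\<lambda>n. norm (h powi (a * (int n)\<^sup>2) * z ^ n))" for z
  proof -
    have q1: "norm (h powi (2 * a)) < 1"
    proof -
      have "norm h powi (2 * a) < norm h powi 0"
        by (intro power_int_strict_decreasing) (use norm_h assms in auto)
      then show ?thesis by (simp add: norm_power_int)
    qed
    have "(\<lambda>n. h powi a * (h powi (2 * a)) ^ n * z) \<longlonglongrightarrow> h powi a * 0 * z"
      by (intro tendsto_intros LIMSEQ_power_zero q1)
    then have "\<exists>N. \<forall>n\<ge>N. norm (h powi a * (h powi (2 * a)) ^ n * z) < 1 / 2"
      using LIMSEQ_D[of "\<lambda>n. h powi a * (h powi (2 * a)) ^ n * z" 0 "1 / 2"] by simp
    then obtain N where N: "\<And>n. n \<ge> N \<Longrightarrow> norm (h powi a * (h powi (2 * a)) ^ n * z) < 1 / 2"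
      by blast
    show ?thesis
    proof (rule summable_ratio_test[of "1 / 2" N])
      fix n assume "n \<ge> N"
      have e: "a * (int (Suc n))\<^sup>2 = a * (int n)\<^sup>2 + (a + 2 * a * int n)"
        by (simp add: algebra_simps power2_eq_square)
      have "h powi (a * (int (Suc n))\<^sup>2) * z ^ Suc n =
          (h powi (a * (int n)\<^sup>2) * z ^ n) * (h powi a * (h powi (2 * a)) ^ n * z)"
        unfolding e power_int_power' by (simp add: power_int_add mult_ac)
      moreover have "norm (h powi (a * (int n)\<^sup>2) * z ^ n) * norm (h powi a * (h powi (2 * a)) ^ n * z)
          \<le> norm (h powi (a * (int n)\<^sup>2) * z ^ n) * (1 / 2)"
        using N[OF \<open>n \<ge> N\<close>] by (intro mult_left_mono) auto
      ultimately show "norm (norm (h powi (a * (int (Suc n))\<^sup>2) * z ^ Suc n)) \<le>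
          1 / 2 * norm (norm (h powi (a * (int n)\<^sup>2) * z ^ n))"
        by (simp only: norm_mult real_norm_def abs_norm_cancel abs_mult mult_ac)
    qed simp
  qed
  show "summable (\<lambda>n. norm (h powi (a * (int n)\<^sup>2) * x powi (int n)))"
    using *[of x] by simp
  show "summable (\<lambda>n. norm (h powi (a * (- int n)\<^sup>2) * x powi (- int n)))"
    using *[of "inverse x"] by (simp add: power_int_minus power_inverse)
qed simp

lemma powi_quadratic_summable:
  assumes "a > 0"
  shows "(\<lambda>\<rho>. norm (h powi (a * \<rho>\<^sup>2 + b * \<rho> + c))) summable_on UNIV"
proof -
  have "(\<lambda>\<rho>. norm (h powi (a * \<rho>\<^sup>2) * (h powi b) powi \<rho>) * norm (h powi c)) summable_on UNIV"
    using assms by (intro summable_on_cmult_left theta_summable) auto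
  moreover have "norm (h powi (a * \<rho>\<^sup>2) * (h powi b) powi \<rho>) * norm (h powi c) = norm (h powi (a * \<rho>\<^sup>2 + b * \<rho> + c))" for \<rho>
    by (simp add: power_int_mult[symmetric] norm_mult[symmetric] powi_mult)
  ultimately show ?thesis by simp
qed

text \<open>The prefactor turns the factors 1 - x q^(-k), for k = 1, ..., N, into 1 - q^k / x. The
  induction adds one factor at each end of the product.\<close>

lemma finite_Jacobi_triple:
  assumes "x \<noteq> 0"
  shows "(- 1) powi (int N) * x powi (- int N) * h powi (int N * (int N + 1)) *
      (\<Prod>i<N + N. 1 - x * h powi (2 * (int i - int N)))
    = (\<Prod>i<N. 1 - x * q ^ i) * (\<Prod>i<N. 1 - q / x * q ^ i)"
proof (induction N)
  case 0
  show ?case by simp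
next
  case (Suc N)
  define F where "F k = 1 - x * h powi (2 * k)" for k
  have "(\<Prod>i<Suc N + Suc N. F (int i - int (Suc N))) = (\<Prod>i<Suc (Suc (N + N)). F (int i - int (Suc N)))"
    by simp
  also have "\<dots> = F (- int (Suc N)) * (\<Prod>i<Suc (N + N). F (int (Suc i) - int (Suc N)))"
    by (subst prod.lessThan_Suc_shift) simp
  also have "\<dots> = F (- int (Suc N)) * ((\<Prod>i<N + N. F (int i - int N)) * F (int N))"
    by simp
  finally have prod: "(\<Prod>i<Suc N + Suc N. F (int i - int (Suc N))) =
      F (- int (Suc N)) * ((\<Prod>i<N + N. F (int i - int N)) * F (int N))" .
  have c: "(- 1) powi (int (Suc N)) * x powi (- int (Suc N)) * h powi (int (Suc N) * (int (Suc N) + 1)) * F (- int (Suc N))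
     = (- 1) powi (int N) * x powi (- int N) * h powi (int N * (int N + 1)) * (1 - q / x * q ^ N)"
  proof -
    have e: "int (Suc N) * (int (Suc N) + 1) = int N * (int N + 1) + 2 * int (Suc N)"
      by (simp add: algebra_simps)
    have h1: "h powi (int (Suc N) * (int (Suc N) + 1)) * F (- int (Suc N)) =
        h powi (int N * (int N + 1)) * (h powi (2 * int (Suc N)) - x)"
      unfolding e F_def by (simp add: ring_distribs mult.left_commute[of _ x] powi_mult del: of_nat_Suc)
    have h2: "(- 1) powi (int (Suc N)) * x powi (- int (Suc N)) * (h powi (2 * int (Suc N)) - x) =
        (- 1) powi (int N) * x powi (- int N) * (1 - q / x * q ^ N)"
      unfolding q_power[symmetric] power_int_minus power_int_of_nat using assms by (simp add: field_simps)
    have "(- 1) powi (int (Suc N)) * x powi (- int (Suc N)) * (h powi (int (Suc N) * (int (Suc N) + 1)) * F (- int (Suc N)))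
       = ((- 1) powi (int (Suc N)) * x powi (- int (Suc N)) * (h powi (2 * int (Suc N)) - x)) * h powi (int N * (int N + 1))"
      unfolding h1 by (simp only: mult_ac)
    then show ?thesis unfolding h2 by (simp only: mult_ac)
  qed
  have "(- 1) powi (int (Suc N)) * x powi (- int (Suc N)) * h powi (int (Suc N) * (int (Suc N) + 1)) *
      (\<Prod>i<Suc N + Suc N. F (int i - int (Suc N))) =
      ((- 1) powi (int (Suc N)) * x powi (- int (Suc N)) * h powi (int (Suc N) * (int (Suc N) + 1)) * F (- int (Suc N))) *
      ((\<Prod>i<N + N. F (int i - int N)) * F (int N))"
    unfolding prod by (simp only: mult_ac)
  also have "\<dots> = ((- 1) powi (int N) * x powi (- int N) * h powi (int N * (int N + 1)) *
      (\<Prod>i<N + N. F (int i - int N))) * (1 - q / x * q ^ N) * F (int N)"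
    unfolding c by (simp only: mult_ac)
  also have "\<dots> = (\<Prod>i<N. 1 - x * q ^ i) * (\<Prod>i<N. 1 - q / x * q ^ i) * (1 - q / x * q ^ N) * F (int N)"
    using Suc.IH by (simp only: F_def)
  also have "F (int N) = 1 - x * q ^ N" by (simp add: F_def q_power)
  finally show ?case
    unfolding F_def prod.lessThan_Suc by (simp only: mult_ac)
qed

text \<open>The q-binomial theorem on the window from -n to n, with n to infinity. Each of the two
  reciprocals in a term tends to 1/(q)_inf, which accounts for the final multiplication by the
  square of (q)_inf.\<close>

theorem Jacobi_triple_product:
  assumes "x \<noteq> 0"
  shows "((\<lambda>\<rho>. (- 1) powi \<rho> * h powi (\<rho> * (\<rho> - 1)) * x powi \<rho>) has_sum
     (qpoch_inf q q * qpoch_inf x q * qpoch_inf (q / x) q)) UNIV"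
proof -
  define \<phi> where "\<phi> \<rho> = (- 1) powi \<rho> * h powi (\<rho> * (\<rho> - 1)) * x powi \<rho>" for \<rho>
  \<comment> \<open>Tannery's theorem is about series over the naturals, so the integers are
    enumerated by \<open>int_decode\<close>.\<close>
  define a where "a k n = \<phi> (int_decode k) * (iq (int n - int_decode k) * iq (int n + int_decode k))" for k n
  define b where "b k = \<phi> (int_decode k) * (1 / qpoch_inf q q * (1 / qpoch_inf q q))" for k
  obtain B where B: "B > 0" "\<And>k. norm (iq k) \<le> B"
    using iq_bounded by blast
  have "norm (\<phi> \<rho>) = norm (h powi (1 * \<rho>\<^sup>2) * (x / h) powi \<rho>)" for \<rho>
  proof -
    have "\<rho> * (\<rho> - 1) = \<rho>\<^sup>2 - \<rho>" by (simp add: algebra_simps power2_eq_square)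
    then show ?thesis unfolding \<phi>_def norm_mult
      by (simp add: norm_power_int power_int_diff power_int_divide_distrib norm_divide)
  qed
  then have "(\<lambda>\<rho>. norm (\<phi> \<rho>)) summable_on UNIV"
    using theta_summable[of "x / h" 1] assms by simp
  then have "(\<lambda>\<rho>. norm (\<phi> \<rho>)) summable_on (range int_decode)"
    by (simp add: surj_int_decode)
  then have "(\<lambda>k. norm (\<phi> (int_decode k))) summable_on UNIV"
    by (subst (asm) summable_on_reindex) (auto simp: inj_int_decode o_def)
  then have sum\<phi>: "summable (\<lambda>k. norm (\<phi> (int_decode k)))"
    by (rule summable_on_imp_summable)
  have T: "eventually (\<lambda>n. summable (\<lambda>k. norm (a k n))) sequentially \<and> summable (\<lambda>n. norm (b n)) \<and>
     (\<lambda>n. suminf (\<lambda>k. a k n)) \<longlonglongrightarrow> suminf b"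
  proof (rule tannerys_theorem)
    fix k
    show "(\<lambda>n. a k n) \<longlonglongrightarrow> b k"
      unfolding a_def b_def using iq_LIMSEQ[of "- int_decode k"] iq_LIMSEQ[of "int_decode k"]
      by (intro tendsto_intros) auto
  next
    have "norm (a k n) \<le> norm (\<phi> (int_decode k)) * (B * B)" for k n
      unfolding a_def norm_mult
      by (intro mult_left_mono mult_mono B) (use B in auto)
    then show "\<forall>\<^sub>F (k, n) in sequentially \<times>\<^sub>F sequentially. norm (a k n) \<le> norm (\<phi> (int_decode k)) * (B * B)"
      by (intro always_eventually) auto
    show "summable (\<lambda>k. norm (\<phi> (int_decode k)) * (B * B))"
      by (intro summable_mult2 sum\<phi>)
  qed simp
  have "suminf (\<lambda>k. a k n) = (\<Prod>i<n. 1 - x * q ^ i) * (\<Prod>i<n. 1 - q / x * q ^ i) * iq (int (n + n) + 0)" for n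
  proof -
    have "suminf (\<lambda>k. a k n) = (\<Sum>k\<in>int_encode ` {- int n..int n}. a k n)"
    proof (rule suminf_finite)
      fix k assume k: "k \<notin> int_encode ` {- int n..int n}"
      have "int_decode k \<notin> {- int n..int n}"
        using k by (metis image_eqI int_decode_inverse)
      then have "int n - int_decode k < 0 \<or> int n + int_decode k < 0" by auto
      then show "a k n = 0" by (auto simp: a_def)
    qed simp
    also have "\<dots> = (\<Sum>\<rho>\<in>{- int n..int n}. \<phi> \<rho> * (iq (int n - \<rho>) * iq (int n + \<rho>)))"
      by (subst sum.reindex) (auto simp: inj_int_encode a_def)
    also have "\<dots> = (- 1) powi (int n) * x powi (- int n) * h powi (int n * (int n + 1)) *
      ((\<Prod>i<n + n. 1 - x * h powi (2 * (int i - int n))) * iq (int n + int n))"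
    proof -
      have "nat (int n + int n) = n + n" by simp
      then show ?thesis
        using q_binomial_theorem_shifted[OF assms, of "int n" "int n"] unfolding \<phi>_def by simp
    qed
    also have "\<dots> = (- 1) powi (int n) * x powi (- int n) * h powi (int n * (int n + 1)) *
      (\<Prod>i<n + n. 1 - x * h powi (2 * (int i - int n))) * iq (int (n + n) + 0)"
      by simp
    finally show ?thesis unfolding finite_Jacobi_triple[OF assms] .
  qed
  moreover have "(\<lambda>n. (\<Prod>i<n. 1 - x * q ^ i) * (\<Prod>i<n. 1 - q / x * q ^ i) * iq (int (n + n) + 0))
     \<longlonglongrightarrow> qpoch_inf x q * qpoch_inf (q / x) q * (1 / qpoch_inf q q)"
  proof (intro tendsto_mult qpoch_inf_LIMSEQ norm_q)
    have "strict_mono (\<lambda>n::nat. n + n)" by (auto simp: strict_mono_def)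
    then show "(\<lambda>n. iq (int (n + n) + 0)) \<longlonglongrightarrow> 1 / qpoch_inf q q"
      using LIMSEQ_subseq_LIMSEQ[OF iq_LIMSEQ[of 0]] unfolding o_def by blast
  qed
  ultimately have "(\<lambda>n. suminf (\<lambda>k. a k n)) \<longlonglongrightarrow> qpoch_inf x q * qpoch_inf (q / x) q * (1 / qpoch_inf q q)"
    by (simp only:)
  then have "suminf b = qpoch_inf x q * qpoch_inf (q / x) q * (1 / qpoch_inf q q)"
    using T LIMSEQ_unique by blast
  then have "(b has_sum (qpoch_inf x q * qpoch_inf (q / x) q * (1 / qpoch_inf q q))) UNIV"
    using T by (metis norm_summable_imp_has_sum summable_norm_cancel summable_sums)
  then have "((\<lambda>k. qpoch_inf q q * qpoch_inf q q * b k) has_sum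
     (qpoch_inf q q * qpoch_inf q q * (qpoch_inf x q * qpoch_inf (q / x) q * (1 / qpoch_inf q q)))) UNIV"
    by (rule has_sum_cmult_right)
  then have "((\<phi> \<circ> int_decode) has_sum (qpoch_inf q q * qpoch_inf x q * qpoch_inf (q / x) q)) UNIV"
    by (simp add: b_def o_def mult_ac)
  then have "(\<phi> has_sum (qpoch_inf q q * qpoch_inf x q * qpoch_inf (q / x) q)) (range int_decode)"
    by (subst has_sum_reindex) (auto simp: inj_int_decode)
  then show ?thesis
    unfolding \<phi>_def by (simp add: surj_int_decode)
qed

section \<open>The bilateral unit Bailey pair\<close>

lemma prod_powi_iq:
  "(\<Prod>i<M. 1 - h powi (2 * (int i - A))) * iq A =
     (- 1) ^ M * h powi (- 2 * A * int M + int M * (int M - 1)) * iq (A - int M)"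
proof (induction M)
  case 0
  show ?case by simp
next
  case (Suc M)
  have i: "iq (A - int (Suc M)) = (1 - h powi (2 * (A - int M))) * iq (A - int M)"
    using iq_rec[of "A - int M"] by (simp add: algebra_simps)
  have e: "- 2 * A * int M + int M * (int M - 1) = (- 2 * A * int (Suc M) + int (Suc M) * (int (Suc M) - 1)) + 2 * (A - int M)"
    by (simp add: algebra_simps)
  have e2: "2 * (A - int M) + 2 * (int M - A) = 0" by simp
  have f: "h powi (2 * (A - int M)) * (1 - h powi (2 * (int M - A))) = - (1 - h powi (2 * (A - int M)))"
    unfolding right_diff_distrib powi_mult e2 by simp
  have "(\<Prod>i<Suc M. 1 - h powi (2 * (int i - A))) * iq A =
     ((\<Prod>i<M. 1 - h powi (2 * (int i - A))) * iq A) * (1 - h powi (2 * (int M - A)))"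
    by (simp add: mult_ac)
  also have "\<dots> = (- 1) ^ M * h powi (- 2 * A * int (Suc M) + int (Suc M) * (int (Suc M) - 1)) * iq (A - int M) *
     (h powi (2 * (A - int M)) * (1 - h powi (2 * (int M - A))))"
    unfolding Suc.IH e powi_mult[of _ "2 * (A - int M)", symmetric] by (simp only: mult_ac)
  finally show ?case
    unfolding f i by (simp only: power_Suc mult_minus_left mult_minus_right mult_1 mult_ac)
qed

text \<open>At x = 1 the q-binomial product is (q^(-A))_M with A = y + m and M = 2y + m, and A - M =
  -y. For y > 0 both sides vanish, on the left through \<open>iq (- y)\<close>; for m = 0 only y = 0
  survives, with value 1, hence the name.\<close>

lemma unit_Bailey_pair:
  assumes "- int (m div 2) \<le> y"
  shows "(\<Sum>\<rho>\<in>{- y - int m..y}. (- 1) powi \<rho> * h powi (\<rho>\<^sup>2 - \<rho>) * kern (int m) \<rho> y) =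
     (- 1) powi y * h powi (y\<^sup>2 - y) * qbinom q (int m + y) (int m + 2 * y)"
proof -
  define A where "A = y + int m"
  define M where "M = nat (A + y)"
  have Ay: "A + y \<ge> 0" and A0: "A \<ge> 0" using assms by (auto simp: A_def)
  have M: "int M = A + y" using Ay by (simp add: M_def)
  have "(\<Sum>\<rho>\<in>{- y - int m..y}. (- 1) powi \<rho> * h powi (\<rho>\<^sup>2 - \<rho>) * kern (int m) \<rho> y) =
      (\<Sum>\<rho>\<in>{- A..y}. (- 1) powi \<rho> * h powi (\<rho> * (\<rho> - 1)) * 1 powi \<rho> * (iq (y - \<rho>) * iq (A + \<rho>)))"
    by (intro sum.cong) (auto simp: A_def kern_def power2_eq_square algebra_simps)
  also have "\<dots> = (- 1) powi A * 1 powi (- A) * h powi (A * (A + 1)) *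
      ((\<Prod>i<M. 1 - 1 * h powi (2 * (int i - A))) * iq (A + y))"
    unfolding M_def by (rule q_binomial_theorem_shifted) (use Ay in auto)
  \<comment> \<open>Inserting \<open>iq A\<close>, nonzero because A is nonnegative, prepares the
    reversal of the product.\<close>
  also have "\<dots> = (- 1) powi A * h powi (A * (A + 1)) *
      (((\<Prod>i<M. 1 - h powi (2 * (int i - A))) * iq A) * (iq (A + y) / iq A))"
    using iq_nonzero[OF A0] by simp
  also have "\<dots> = ((- 1) powi A * (- 1) ^ M) * (h powi (A * (A + 1)) * h powi (- 2 * A * int M + int M * (int M - 1))) *
      (iq (- y) * (iq (A + y) / iq A))"
    unfolding prod_powi_iq by (simp add: M mult_ac)
  also have "h powi (A * (A + 1)) * h powi (- 2 * A * int M + int M * (int M - 1)) = h powi (y\<^sup>2 - y)"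
  proof -
    have "A * (A + 1) + (- 2 * A * int M + int M * (int M - 1)) = y\<^sup>2 - y"
      unfolding M by (simp add: algebra_simps power2_eq_square)
    then show ?thesis by (simp only: powi_mult)
  qed
  also have "(- 1 :: complex) powi A * (- 1) ^ M = (- 1) powi y"
  proof -
    have "(- 1 :: complex) powi A * (- 1) ^ M = (- 1) powi A * (- 1) powi (int M)" by simp
    also have "\<dots> = (- 1) powi (A + A + y)" unfolding M by (simp add: power_int_add mult.assoc)
    also have "\<dots> = (- 1) powi y" by (simp add: power_int_minus_left)
    finally show ?thesis .
  qed
  also have "iq (- y) * (iq (A + y) / iq A) = qbinom q (int m + y) (int m + 2 * y)"
  proof (cases "y \<le> 0")
    case True
    have "qpoch q q k = inverse (iq k)" for k by (simp add: inverse_qpoch_q[symmetric])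
    then show ?thesis using True Ay by (simp add: qbinom_def A_def field_simps)
  next
    case False
    then show ?thesis by (simp add: qbinom_def)
  qed
  finally show ?thesis .
qed

end

section \<open>Iterated sums along decreasing chains\<close>

lemma summable_on_times_real:
  fixes f :: "'a \<Rightarrow> real" and g :: "'b \<Rightarrow> real"
  assumes "f summable_on A" and "g summable_on B"
    and "\<And>x. x \<in> A \<Longrightarrow> f x \<ge> 0" and "\<And>y. y \<in> B \<Longrightarrow> g y \<ge> 0"
  shows "(\<lambda>(x, y). f x * g y) summable_on (A \<times> B)"
proof (rule summable_on_SigmaI)
  show "((\<lambda>y. case (x, y) of (x, y) \<Rightarrow> f x * g y) has_sum (f x * infsum g B)) B" for x
    using assms(2) by (auto intro!: has_sum_cmult_right)
  show "(\<lambda>x. f x * infsum g B) summable_on A"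
    by (intro summable_on_cmult_left assms)
qed (use assms in auto)

lemma PiE_insert_image:
  "PiE (insert x F) B = (\<lambda>(g, y). g(x := y)) ` (PiE F B \<times> B x)"
  unfolding PiE_insert_eq by (subst swap_product[symmetric]) (simp add: image_image case_prod_unfold)

lemma summable_on_PiE_prod:
  fixes g :: "'a \<Rightarrow> 'b \<Rightarrow> real"
  assumes "finite A" and "\<And>j. j \<in> A \<Longrightarrow> g j summable_on B j"
    and "\<And>j x. j \<in> A \<Longrightarrow> x \<in> B j \<Longrightarrow> g j x \<ge> 0"
  shows "(\<lambda>s. \<Prod>j\<in>A. g j (s j)) summable_on PiE A B"
  using assms
proof (induction A rule: finite_induct)
  case empty
  show ?case by (simp add: summable_on_finite)
next
  case (insert x F)
  have "(\<lambda>(s, y). (\<Prod>j\<in>F. g j (s j)) * g x y) summable_on (PiE F B \<times> B x)"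
    using insert by (intro summable_on_times_real prod_nonneg insert.IH) (auto simp: PiE_mem)
  also have "?this \<longleftrightarrow> ((\<lambda>s. \<Prod>j\<in>insert x F. g j (s j)) \<circ> (\<lambda>(s, y). s(x := y))) summable_on (PiE F B \<times> B x)"
  proof (rule summable_on_cong)
    fix p assume "p \<in> PiE F B \<times> B x"
    have "(\<Prod>j\<in>F. g j (((fst p)(x := snd p)) j)) = (\<Prod>j\<in>F. g j (fst p j))"
      using insert by (intro prod.cong) auto
    then show "(case p of (s, y) \<Rightarrow> (\<Prod>j\<in>F. g j (s j)) * g x y) =
       ((\<lambda>s. \<Prod>j\<in>insert x F. g j (s j)) \<circ> (\<lambda>(s, y). s(x := y))) p"
      using insert.hyps by (cases p) (simp add: mult.commute)
  qed
  finally show ?case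
    unfolding PiE_insert_image using insert.hyps by (subst summable_on_reindex) (auto intro: inj_combinator')
qed

context nome
begin

lemma powi_sum: "finite A \<Longrightarrow> h powi (\<Sum>j\<in>A. f j) = (\<Prod>j\<in>A. h powi f j)"
  by (induction A rule: finite_induct) (auto simp: power_int_add)

text \<open>The order of the variables is not imposed: \<open>iq\<close> vanishes where it fails, so
  sums may run over a full product set. The last factor b stores the result of the summations
  already carried out.\<close>

definition chain :: "(nat \<Rightarrow> int \<Rightarrow> complex) \<Rightarrow> (int \<Rightarrow> complex) \<Rightarrow> nat \<Rightarrow> (nat \<Rightarrow> int) \<Rightarrow> complex" where
  "chain w b n s = (\<Prod>j=1..<n. w j (s j) * iq (s j - s (j + 1))) * b (s n)"

text \<open>Convergence is inherited: the sum over n + 1 variables exists by assumption, so the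
  inner variable may be summed first, and its sum is finite because \<open>iq (s n - y)\<close> is 0
  for y > s n.\<close>

lemma chain_peel:
  assumes "n \<ge> 1" and "(chain w b (Suc n) has_sum S) (PiE {1..Suc n} (\<lambda>_. {L..}))"
  shows "(chain w (\<lambda>x. w n x * (\<Sum>y\<in>{L..x}. iq (x - y) * b y)) n has_sum S) (PiE {1..n} (\<lambda>_. {L..}))"
proof -
  have ins: "{1..Suc n} = insert (Suc n) {1..n}" by auto
  have "((chain w b (Suc n) \<circ> (\<lambda>(s, y). s(Suc n := y))) has_sum S) (PiE {1..n} (\<lambda>_. {L..}) \<times> {L..})"
    using assms(2) unfolding ins PiE_insert_image
    by (subst (asm) has_sum_reindex) (auto intro: inj_combinator')
  then show ?thesis
  proof (rule has_sum_SigmaD)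
    fix s assume "s \<in> PiE {1..n} (\<lambda>_. {L..})"
    define C where "C = (\<Prod>j=1..<n. w j (s j) * iq (s j - s (j + 1))) * w n (s n)"
    have eq: "(chain w b (Suc n) \<circ> (\<lambda>(s, y). s(Suc n := y))) (s, y) = C * (iq (s n - y) * b y)" for y
    proof -
      have "(\<Prod>j=1..<n. w j ((s(Suc n := y)) j) * iq ((s(Suc n := y)) j - (s(Suc n := y)) (j + 1))) =
          (\<Prod>j=1..<n. w j (s j) * iq (s j - s (j + 1)))"
        by (intro prod.cong) auto
      then show ?thesis
        using assms(1) by (simp add: chain_def C_def prod.atLeastLessThan_Suc mult_ac)
    qed
    have "((\<lambda>y. C * (iq (s n - y) * b y)) has_sum (C * (\<Sum>y\<in>{L..s n}. iq (s n - y) * b y))) {L..}"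
    proof (rule has_sum_cmult_right)
      have "((\<lambda>y. iq (s n - y) * b y) has_sum (\<Sum>y\<in>{L..s n}. iq (s n - y) * b y)) {L..s n}"
        by (rule has_sum_finite) simp
      then show "((\<lambda>y. iq (s n - y) * b y) has_sum (\<Sum>y\<in>{L..s n}. iq (s n - y) * b y)) {L..}"
        by (subst has_sum_cong_neutral[of "{L..s n}" _ _ "\<lambda>y. iq (s n - y) * b y"]) auto
    qed
    then show "((\<lambda>y. (chain w b (Suc n) \<circ> (\<lambda>(s, y). s(Suc n := y))) (s, y)) has_sum
        chain w (\<lambda>x. w n x * (\<Sum>y\<in>{L..x}. iq (x - y) * b y)) n s) {L..}"
      unfolding eq by (simp add: chain_def C_def mult.assoc)
  qed
qed

lemma chain_norm_le:
  assumes "n \<ge> 1" and "\<And>k. norm (iq k) \<le> B"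
  shows "norm (chain w b n s) \<le> (\<Prod>j=1..n. if j = n then norm (b (s n)) else norm (w j (s j)) * B)"
proof -
  have "norm (chain w b n s) = (\<Prod>j=1..<n. norm (w j (s j)) * norm (iq (s j - s (j + 1)))) * norm (b (s n))"
    by (simp add: chain_def norm_mult prod_norm[symmetric])
  also have "\<dots> \<le> (\<Prod>j=1..<n. norm (w j (s j)) * B) * norm (b (s n))"
    by (intro mult_right_mono prod_mono) (auto intro!: mult_left_mono assms)
  also have "\<dots> = (\<Prod>j=1..n. if j = n then norm (b (s n)) else norm (w j (s j)) * B)"
  proof -
    have "{1..n} = insert n {1..<n}" using assms by auto
    moreover have "(\<Prod>j=1..<n. if j = n then norm (b (s n)) else norm (w j (s j)) * B) = (\<Prod>j=1..<n. norm (w j (s j)) * B)"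
      by (intro prod.cong) auto
    ultimately show ?thesis by (simp add: mult.commute)
  qed
  finally show ?thesis .
qed

text \<open>Once every \<open>iq\<close> is replaced by a uniform bound, the variables separate and
  the dominating function is a product of summable functions of one variable.\<close>

lemma chain_summable:
  assumes "n \<ge> 1" and "\<And>j. j \<in> {1..<n} \<Longrightarrow> (\<lambda>x. norm (w j x)) summable_on {L..}"
    and "(\<lambda>x. norm (b x)) summable_on {L..}"
  shows "chain w b n summable_on (PiE {1..n} (\<lambda>_. {L..}))"
proof -
  obtain B where B: "B > 0" "\<And>k. norm (iq k) \<le> B"
    using iq_bounded by blast
  define g where "g j x = (if j = n then norm (b x) else norm (w j x) * B)" for j x
  have "(\<lambda>s. \<Prod>j\<in>{1..n}. g j (s j)) summable_on (PiE {1..n} (\<lambda>_. {L..}))"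
  proof (rule summable_on_PiE_prod)
    fix j assume "j \<in> {1..n}"
    then show "g j summable_on {L..}"
      unfolding g_def using assms(2,3) by (cases "j = n") (auto intro!: summable_on_cmult_left)
  qed (use B in \<open>auto simp: g_def\<close>)
  then have "(\<lambda>s. norm (chain w b n s)) summable_on (PiE {1..n} (\<lambda>_. {L..}))"
  proof (rule Infinite_Sum.abs_summable_on_comparison_test')
    fix s
    have "(\<Prod>j=1..n. g j (s j)) = (\<Prod>j=1..n. if j = n then norm (b (s n)) else norm (w j (s j)) * B)"
      by (intro prod.cong) (auto simp: g_def)
    then show "norm (chain w b n s) \<le> (\<Prod>j=1..n. g j (s j))"
      using chain_norm_le[OF assms(1) B(2)] by simp
  qed
  then show ?thesis by (rule abs_summable_summable)
qed

text \<open>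
  The kernel \<open>kern m \<rho>\<close> alone is not stable under the Bailey step with parameter \<open>q\<^bsup>m-1\<^esup>\<close>; adding
  a multiple of \<open>kern (m - 1) (\<rho> + 1)\<close> makes it so, also at \<open>2 \<rho> = - m\<close>, where the usual change of
  parameter in a Bailey pair would divide by \<open>1 - q\<^bsup>m+2\<rho>\<^esup> = 0\<close>.
\<close>

definition kern_ext :: "nat \<Rightarrow> complex \<Rightarrow> int \<Rightarrow> int \<Rightarrow> complex" where
  "kern_ext m e \<rho> x = kern (int m) \<rho> x + e * kern (int m - 1) (\<rho> + 1) x"

definition pair_sum :: "nat \<Rightarrow> (int \<Rightarrow> complex) \<Rightarrow> (int \<Rightarrow> complex) \<Rightarrow> int \<Rightarrow> complex" where
  "pair_sum m c e x = (\<Sum>\<rho>\<in>{- x - int m..x}. c \<rho> * kern_ext m (e \<rho>) \<rho> x)"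

lemma kern_ext_eq_0: "\<rho> \<notin> {- x - int m..x} \<Longrightarrow> kern_ext m e \<rho> x = 0"
  by (auto simp: kern_ext_def kern_eq_0')

text \<open>An exchange of two finite sums: what a summation does to each kernel becomes a change of
  the coefficients c and of the multiples e.\<close>

lemma pair_sum_transfer:
  assumes "\<And>\<rho>. (\<Sum>y\<in>{L..x}. iq (x - y) * W y * kern_ext m (e \<rho>) \<rho> y) = V \<rho> * kern_ext m (e' \<rho>) \<rho> x"
  shows "(\<Sum>y\<in>{L..x}. iq (x - y) * (W y * pair_sum m c e y)) = pair_sum m (\<lambda>\<rho>. c \<rho> * V \<rho>) e' x"
proof -
  have ext: "pair_sum m c e y = (\<Sum>\<rho>\<in>{- x - int m..x}. c \<rho> * kern_ext m (e \<rho>) \<rho> y)" if "y \<le> x" for y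
    unfolding pair_sum_def using that by (intro sum.mono_neutral_left) (auto simp: kern_ext_eq_0)
  have "(\<Sum>y\<in>{L..x}. iq (x - y) * (W y * pair_sum m c e y)) =
     (\<Sum>y\<in>{L..x}. \<Sum>\<rho>\<in>{- x - int m..x}. c \<rho> * (iq (x - y) * W y * kern_ext m (e \<rho>) \<rho> y))"
    by (intro sum.cong refl) (simp add: ext sum_distrib_left mult_ac)
  also have "\<dots> = (\<Sum>\<rho>\<in>{- x - int m..x}. c \<rho> * (\<Sum>y\<in>{L..x}. iq (x - y) * W y * kern_ext m (e \<rho>) \<rho> y))"
    by (subst sum.swap) (simp only: sum_distrib_left)
  also have "\<dots> = pair_sum m (\<lambda>\<rho>. c \<rho> * V \<rho>) e' x"
    unfolding assms pair_sum_def by (simp add: mult.assoc)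
  finally show ?thesis .
qed

lemma kern_ext_step:
  assumes "2 * L \<le> 1 - int m"
  shows "(\<Sum>y\<in>{L..x}. iq (x - y) * h powi (2 * y\<^sup>2 + 2 * int m * y) * kern_ext m 0 \<rho> y) =
     h powi (2 * \<rho>\<^sup>2 + 2 * int m * \<rho>) * kern_ext m 0 \<rho> x"
  using Bailey_step[OF assms] by (simp add: kern_ext_def)

lemma kern_ext_step_qpoch:
  assumes "2 * L \<le> 1 - int m"
  shows "(\<Sum>y\<in>{L..x}. iq (x - y) * (h powi (y\<^sup>2 + int m * y) * qpoch (- (h powi (int m + 1))) q y) * kern_ext m 0 \<rho> y) =
     (h powi (\<rho>\<^sup>2 + int m * \<rho>) * qpoch (- (h powi (int m + 1))) q x) * kern_ext m 0 \<rho> x"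
  using Bailey_step_qpoch[OF assms] by (simp add: kern_ext_def)

text \<open>By \<open>kern_shift\<close> the extra factor q^(-y) leaves a multiple of the kernel of
  parameter m and one of parameter m - 1 at \<rho> + 1, both eigenvectors of ordinary Bailey steps.
  The second picks up q^(2\<rho>+m) relative to the first, whence e becomes q^(2\<rho>+m) (1 +
  e).\<close>

lemma kern_ext_step_shifted:
  assumes "2 * L \<le> 1 - int m"
  shows "(\<Sum>y\<in>{L..x}. iq (x - y) * h powi (2 * y\<^sup>2 + 2 * (int m - 1) * y) * kern_ext m e \<rho> y) =
     h powi (2 * \<rho>\<^sup>2 + 2 * (int m - 1) * \<rho>) * kern_ext m (h powi (2 * (2 * \<rho> + int m)) * (1 + e)) \<rho> x"
proof -
  define K where "K = kern (int m - 1) (\<rho> + 1)"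
  have t: "iq (x - y) * h powi (2 * y\<^sup>2 + 2 * (int m - 1) * y) * kern_ext m e \<rho> y =
     h powi (- 2 * \<rho>) * (iq (x - y) * h powi (2 * y\<^sup>2 + 2 * int m * y) * kern (int m) \<rho> y)
      + (1 + e) * (iq (x - y) * h powi (2 * y\<^sup>2 + 2 * (int m - 1) * y) * K y)" for y
  proof -
    have e1: "h powi (2 * y\<^sup>2 + 2 * (int m - 1) * y) = h powi (2 * y\<^sup>2 + 2 * int m * y) * h powi (- 2 * y)"
      unfolding powi_mult by (simp add: algebra_simps)
    have "iq (x - y) * h powi (2 * y\<^sup>2 + 2 * (int m - 1) * y) * kern (int m) \<rho> y =
        iq (x - y) * h powi (2 * y\<^sup>2 + 2 * int m * y) * (h powi (- 2 * y) * kern (int m) \<rho> y)"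
      unfolding e1 by (simp only: mult_ac)
    also have "\<dots> = h powi (- 2 * \<rho>) * (iq (x - y) * h powi (2 * y\<^sup>2 + 2 * int m * y) * kern (int m) \<rho> y)
        + iq (x - y) * h powi (2 * y\<^sup>2 + 2 * (int m - 1) * y) * K y"
      unfolding kern_shift[of y "int m" \<rho>] e1 K_def by (simp only: ring_distribs mult_ac)
    finally show ?thesis
      unfolding kern_ext_def K_def[symmetric] by (simp only: ring_distribs mult_ac mult_1 add_ac)
  qed
  have L2: "2 * L \<le> 1 - (int m - 1)" using assms by simp
  have e2: "h powi (2 * \<rho>\<^sup>2 + 2 * int m * \<rho>) = h powi (2 * \<rho>) * h powi (2 * \<rho>\<^sup>2 + 2 * (int m - 1) * \<rho>)"
    unfolding powi_mult by (simp add: algebra_simps)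
  have e3: "h powi (2 * (\<rho> + 1)\<^sup>2 + 2 * (int m - 1) * (\<rho> + 1)) =
      h powi (2 * \<rho>\<^sup>2 + 2 * (int m - 1) * \<rho>) * h powi (2 * (2 * \<rho> + int m))"
    unfolding powi_mult by (simp add: algebra_simps power2_eq_square)
  have e4: "h powi (- 2 * \<rho>) * h powi (2 * \<rho>) = 1"
    unfolding powi_mult by simp
  have alg: "a * (b * w * k) + (1 + e) * (w * p * k') = w * (k + p * (1 + e) * k')" if "a * b = 1"
    for a b w k p k' :: complex
  proof -
    have "a * (b * w * k) = (a * b) * (w * k)" by (simp only: mult.assoc)
    then show ?thesis using that by (simp add: algebra_simps)
  qed
  show ?thesis
    unfolding t sum.distrib sum_distrib_left[symmetric] Bailey_step[OF assms] K_def Bailey_step[OF L2]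
    unfolding kern_ext_def e2 e3 by (rule alg[OF e4])
qed

end

section \<open>Reduction of the multiple sum\<close>

context nome
begin

definition weight_exp :: "nat \<Rightarrow> nat \<Rightarrow> nat \<Rightarrow> int \<Rightarrow> int" where
  "weight_exp m i j x = (if j = 1 then x\<^sup>2 + int m * x + x else 2 * x\<^sup>2 + 2 * int m * x) - (if j \<le> i then 2 * x else 0)"

definition weight :: "nat \<Rightarrow> nat \<Rightarrow> nat \<Rightarrow> int \<Rightarrow> complex" where
  "weight m i j x = h powi (weight_exp m i j x) * (if j = 1 then qpoch (- (h powi int m)) q x else 1)"

definition weight_inner :: "nat \<Rightarrow> nat \<Rightarrow> nat \<Rightarrow> nat \<Rightarrow> int \<Rightarrow> complex" where
  "weight_inner m r i j x = weight m i j x * (if j = r - 1 then inverse (qpoch (- (h powi (int m + 1))) q x) else 1)"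

text \<open>Grouped so that the first bracket is the weight of \<open>Bailey_step_qpoch\<close> and
  the second is the unit Bailey pair.\<close>

definition weight_last :: "nat \<Rightarrow> int \<Rightarrow> complex" where
  "weight_last m y = (h powi (y\<^sup>2 + int m * y) * qpoch (- (h powi (int m + 1))) q y) *
     ((- 1) powi y * h powi (y\<^sup>2 - y) * qbinom q (int m + y) (int m + 2 * y))"

lemma summand_eq_chain:
  assumes "r \<ge> 2" and "i \<le> r - 1"
  shows "summand q h m r i s = chain (weight_inner m r i) (weight_last m) r s"
proof -
  have split1: "{1..<r} = insert 1 {2..<r}" and split2: "{2..r} = insert r {2..<r}"
    using assms by auto
  have "(\<Sum>j=1..i. s j) = (\<Sum>j=1..<r. if j \<le> i then s j else 0)"
    using assms by (intro sum.mono_neutral_cong_left) auto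
  also have "2 * \<dots> = (\<Sum>j=1..<r. if j \<le> i then 2 * s j else 0)"
    unfolding sum_distrib_left by (intro sum.cong) auto
  finally have si: "2 * (\<Sum>j=1..i. s j) = (\<Sum>j=1..<r. if j \<le> i then 2 * s j else 0)" .
  have "(\<Sum>j=1..<r. weight_exp m i j (s j)) =
     (\<Sum>j=1..<r. (if j = 1 then (s j)\<^sup>2 + int m * s j + s j else 2 * (s j)\<^sup>2 + 2 * int m * s j)) - 2 * (\<Sum>j=1..i. s j)"
    unfolding weight_exp_def sum_subtractf si ..
  also have "(\<Sum>j=1..<r. (if j = 1 then (s j)\<^sup>2 + int m * s j + s j else 2 * (s j)\<^sup>2 + 2 * int m * s j)) =
     (s 1)\<^sup>2 + int m * s 1 + s 1 + (\<Sum>j=2..<r. (if j = 1 then (s j)\<^sup>2 + int m * s j + s j else 2 * (s j)\<^sup>2 + 2 * int m * s j))"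
    unfolding split1 by simp
  also have "(\<Sum>j=2..<r. (if j = 1 then (s j)\<^sup>2 + int m * s j + s j else 2 * (s j)\<^sup>2 + 2 * int m * s j)) =
     (\<Sum>j=2..<r. 2 * (s j)\<^sup>2 + 2 * int m * s j)"
    by (intro sum.cong) auto
  also have "\<dots> = 2 * (\<Sum>j=2..<r. (s j)\<^sup>2) + 2 * int m * (\<Sum>j=2..<r. s j)"
    by (simp add: sum.distrib sum_distrib_left)
  finally have E: "(s 1)\<^sup>2 + 2 * (\<Sum>j=2..r. (s j)\<^sup>2) + int m * (s 1 + 2 * (\<Sum>j=2..r. s j)) + s 1 - 2 * (\<Sum>j=1..i. s j) =
     (\<Sum>j=1..<r. weight_exp m i j (s j)) + (2 * (s r)\<^sup>2 + 2 * int m * s r)"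
    unfolding split2 by (simp add: algebra_simps)
  have P1: "(\<Prod>j=1..<r. if j = 1 then qpoch (- (h powi int m)) q (s j) else 1) = qpoch (- (h powi int m)) q (s 1)"
    using assms by (subst prod.delta) auto
  have P2: "(\<Prod>j=1..<r. if j = r - 1 then inverse (qpoch (- (h powi (int m + 1))) q (s j)) else 1) =
      inverse (qpoch (- (h powi (int m + 1))) q (s (r - 1)))"
    using assms by (subst prod.delta) auto
  have P3: "(\<Prod>j=1..<r. iq (s j - s (j + 1))) = inverse (\<Prod>j=1..r-1. qpoch q q (s j - s (j + 1)))"
  proof -
    have "{1..<r} = {1..r-1}" using assms by auto
    then show ?thesis by (simp add: prod_inversef[symmetric] inverse_qpoch_q o_def)
  qed
  have ch: "chain (weight_inner m r i) (weight_last m) r s = h powi (\<Sum>j=1..<r. weight_exp m i j (s j)) * qpoch (- (h powi int m)) q (s 1) *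
     inverse (qpoch (- (h powi (int m + 1))) q (s (r - 1))) * inverse (\<Prod>j=1..r-1. qpoch q q (s j - s (j + 1))) * weight_last m (s r)"
    unfolding chain_def weight_inner_def weight_def prod.distrib P1 P2 P3 by (simp add: powi_sum)
  \<comment> \<open>The factor q^(-(m+1)s_r/2) splits the exponent of s_r between the Bailey weight
    and the unit pair.\<close>
  have e: "2 * (s r)\<^sup>2 + 2 * int m * s r + - (int m + 1) * s r = (s r)\<^sup>2 + int m * s r + ((s r)\<^sup>2 - s r)"
    by (simp add: algebra_simps)
  have "h powi (2 * (s r)\<^sup>2 + 2 * int m * s r) * h powi (- (int m + 1) * s r) =
      h powi ((s r)\<^sup>2 + int m * s r) * h powi ((s r)\<^sup>2 - s r)"
    by (simp only: powi_mult e)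
  then have wl: "weight_last m (s r) = qpoch (- (h powi (int m + 1))) q (s r) * (- 1) powi s r *
      (h powi (2 * (s r)\<^sup>2 + 2 * int m * s r) * h powi (- (int m + 1) * s r)) * qbinom q (int m + s r) (int m + 2 * s r)"
    unfolding weight_last_def by (simp only: mult_ac)
  have hm: "h ^ m = h powi int m" "h ^ (m + 1) = h powi (int m + 1)"
    by (simp_all add: power_int_add)
  show ?thesis
    unfolding summand_def E hm ch wl powi_mult[symmetric, of _ "2 * (s r)\<^sup>2 + 2 * int m * s r"]
      divide_inverse inverse_mult_distrib by (simp only: mult_ac)
qed

lemma weight_summable:
  assumes "\<And>x. x \<ge> L \<Longrightarrow> norm (c x) \<le> B"
  shows "(\<lambda>x. norm (weight m i j x * c x)) summable_on {L..}"
proof -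
  obtain B1 where B1: "B1 > 0" "\<And>s. s \<ge> L \<Longrightarrow> norm (qpoch (- (h powi int m)) q s) \<le> B1"
    using qpoch_neg_powi_bounded[of L "int m"] by metis
  define a b where "a = (if j = 1 then 1 else 2 :: int)"
    and "b = (if j = 1 then int m + 1 else 2 * int m) - (if j \<le> i then 2 else 0)"
  have weight_exp: "weight_exp m i j x = a * x\<^sup>2 + b * x + 0" for x
    by (simp add: weight_exp_def a_def b_def algebra_simps)
  have "(\<lambda>x. norm (h powi (a * x\<^sup>2 + b * x + 0))) summable_on {L..}"
    using powi_quadratic_summable[of a b 0] by (rule summable_on_subset) (auto simp: a_def)
  then have "(\<lambda>x. norm (h powi (weight_exp m i j x)) * (max B1 1 * B)) summable_on {L..}"
    unfolding weight_exp by (rule summable_on_cmult_left)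
  then show ?thesis
  proof (rule Infinite_Sum.abs_summable_on_comparison_test')
    fix x assume x: "x \<in> {L..}"
    have "norm (if j = 1 then qpoch (- (h powi int m)) q x else 1) \<le> max B1 1"
      using B1(2)[of x] x by auto
    moreover have "norm (c x) \<le> B" using assms x by auto
    ultimately show "norm (weight m i j x * c x) \<le> norm (h powi (weight_exp m i j x)) * (max B1 1 * B)"
      unfolding weight_def norm_mult mult.assoc by (intro mult_left_mono mult_mono) auto
  qed
qed

text \<open>For y > 0 the lower entry m + 2y of the Gaussian binomial exceeds the upper one, so only
  finitely many y remain.\<close>

lemma weight_last_summable: "(\<lambda>y. norm (weight_last m y)) summable_on {L..}"
proof -
  have "(\<lambda>y. norm (weight_last m y)) summable_on {L..0}"
    by (rule summable_on_finite) simp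
  then show ?thesis
    by (subst summable_on_cong_neutral[of "{L..0}" _ _ "\<lambda>y. norm (weight_last m y)"]) (auto simp: weight_last_def qbinom_def)
qed

text \<open>All s_j are at least s_r on the index set, which therefore lies in the product of half
  lines; on the rest of that product some \<open>iq\<close> is 0.\<close>

lemma summand_chain_has_sum:
  assumes "r \<ge> 2" and "i \<le> r - 1"
  obtains S where "(summand q h m r i has_sum S) (index_set m r)"
    and "(chain (weight_inner m r i) (weight_last m) r has_sum S) (PiE {1..r} (\<lambda>_. {- int (m div 2)..}))"
proof -
  define L where "L = - int (m div 2)"
  obtain B where B: "B > 0" "\<And>s. s \<ge> L \<Longrightarrow> norm (inverse (qpoch (- (h powi (int m + 1))) q s)) \<le> B"
    using qpoch_neg_powi_bounded[of L "int m + 1"] by metis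
  have "chain (weight_inner m r i) (weight_last m) r summable_on (PiE {1..r} (\<lambda>_. {L..}))"
  proof (rule chain_summable)
    fix j
    show "(\<lambda>x. norm (weight_inner m r i j x)) summable_on {L..}"
      unfolding weight_inner_def by (rule weight_summable[of L _ "max B 1"]) (use B in \<open>auto intro: max.coboundedI1\<close>)
  qed (use assms weight_last_summable in auto)
  then obtain S where S: "(chain (weight_inner m r i) (weight_last m) r has_sum S) (PiE {1..r} (\<lambda>_. {L..}))"
    by (auto simp: summable_on_def)
  have sub: "index_set m r \<subseteq> PiE {1..r} (\<lambda>_. {L..})"
  proof
    fix s assume s: "s \<in> index_set m r"
    have "s j \<ge> L" if "j \<in> {1..r}" for j
    proof -
      have "j \<le> r" using that by simp
      then show ?thesis using that
      proof (induction j rule: inc_induct)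
        case base
        then show ?case using s by (auto simp: index_set_def L_def)
      next
        case (step n)
        then have "s (n + 1) \<le> s n" using s by (auto simp: index_set_def)
        moreover have "s (n + 1) \<ge> L" using step by auto
        ultimately show ?case by linarith
      qed
    qed
    then show "s \<in> PiE {1..r} (\<lambda>_. {L..})"
      using s by (auto simp: index_set_def PiE_iff)
  qed
  have zero: "chain (weight_inner m r i) (weight_last m) r s = 0" if s: "s \<in> PiE {1..r} (\<lambda>_. {L..}) - index_set m r" for s
  proof -
    have "- int (m div 2) \<le> s r" using s assms by (auto simp: L_def PiE_iff)
    then obtain j where j: "j \<in> {1..<r}" "\<not> s (j + 1) \<le> s j"
      using s by (auto simp: index_set_def PiE_iff)
    then have "iq (s j - s (j + 1)) = 0" by simp
    then have "(\<Prod>j=1..<r. weight_inner m r i j (s j) * iq (s j - s (j + 1))) = 0"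
      using j(1) by (intro prod_zero) auto
    then show ?thesis by (simp add: chain_def)
  qed
  have "(summand q h m r i has_sum S) (index_set m r) \<longleftrightarrow>
      (chain (weight_inner m r i) (weight_last m) r has_sum S) (PiE {1..r} (\<lambda>_. {L..}))"
    by (rule has_sum_cong_neutral) (use sub zero summand_eq_chain[OF assms] in auto)
  then show ?thesis using S that unfolding L_def by blast
qed

text \<open>A counts the steps with parameter q^m and B those with parameter q^(m-1). The value at A
  = B = 0 is the unit pair after the summation over s_r.\<close>

definition pair_coeff :: "nat \<Rightarrow> nat \<Rightarrow> nat \<Rightarrow> int \<Rightarrow> complex" where
  "pair_coeff m A B \<rho> = (- 1) powi \<rho> * h powi ((2 + 2 * int A + 2 * int B) * \<rho>\<^sup>2 +
      (int m - 1 + 2 * int m * int A + 2 * (int m - 1) * int B) * \<rho>)"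

definition ext_coeff :: "nat \<Rightarrow> nat \<Rightarrow> int \<Rightarrow> complex" where
  "ext_coeff m B \<rho> = (\<Sum>l=1..B. h powi (2 * int l * (2 * \<rho> + int m)))"

lemma pair_coeff_Suc1: "pair_coeff m A B \<rho> * h powi (2 * \<rho>\<^sup>2 + 2 * int m * \<rho>) = pair_coeff m (Suc A) B \<rho>"
  unfolding pair_coeff_def mult.assoc powi_mult by (simp add: algebra_simps)

lemma pair_coeff_Suc2: "pair_coeff m A B \<rho> * h powi (2 * \<rho>\<^sup>2 + 2 * (int m - 1) * \<rho>) = pair_coeff m A (Suc B) \<rho>"
  unfolding pair_coeff_def mult.assoc powi_mult by (simp add: algebra_simps)

text \<open>\<open>ext_coeff\<close> is thus the iterate of the map of e in
  \<open>kern_ext_step_shifted\<close>, started at 0.\<close>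

lemma ext_coeff_Suc: "h powi (2 * (2 * \<rho> + int m)) * (1 + ext_coeff m B \<rho>) = ext_coeff m (Suc B) \<rho>"
proof (induction B)
  case 0
  show ?case by (simp add: ext_coeff_def)
next
  case (Suc B)
  have e: "2 * (2 * \<rho> + int m) + 2 * int (Suc B) * (2 * \<rho> + int m) = 2 * int (Suc (Suc B)) * (2 * \<rho> + int m)"
    by (simp add: algebra_simps)
  have S: "ext_coeff m (Suc B) \<rho> = ext_coeff m B \<rho> + h powi (2 * int (Suc B) * (2 * \<rho> + int m))" for B
    by (simp add: ext_coeff_def)
  have "h powi (2 * (2 * \<rho> + int m)) * (1 + ext_coeff m (Suc B) \<rho>) =
     h powi (2 * (2 * \<rho> + int m)) * (1 + ext_coeff m B \<rho>) +
     h powi (2 * (2 * \<rho> + int m)) * h powi (2 * int (Suc B) * (2 * \<rho> + int m))"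
    unfolding S[of B] by (simp only: ring_distribs add.assoc)
  also have "\<dots> = ext_coeff m (Suc B) \<rho> + h powi (2 * int (Suc (Suc B)) * (2 * \<rho> + int m))"
    unfolding Suc.IH powi_mult e ..
  finally show ?case unfolding S[of "Suc B"] .
qed

lemma chain_cong:
  assumes "\<And>j x. j \<in> {1..<n} \<Longrightarrow> w j x = w' j x" and "b (s n) = b' (s n)"
  shows "chain w b n s = chain w' b' n s"
  unfolding chain_def using assms by (intro arg_cong2[where f = "(*)"] prod.cong) auto

text \<open>The sum over s_r expands the unit pair into kernels and produces (-q^((m+1)/2))_x, which
  cancels against the denominator carried by \<open>weight_inner\<close> at index r - 1.\<close>

lemma first_peel:
  assumes "r \<ge> 2" and "(chain (weight_inner m r i) (weight_last m) r has_sum S) (PiE {1..r} (\<lambda>_. {- int (m div 2)..}))"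
  shows "(chain (weight m i) (\<lambda>x. weight m i (r - 1) x * pair_sum m (pair_coeff m 0 0) (ext_coeff m 0) x) (r - 1) has_sum S)
     (PiE {1..r - 1} (\<lambda>_. {- int (m div 2)..}))"
proof -
  define L where "L = - int (m div 2)"
  have L: "2 * L \<le> 1 - int m" unfolding L_def by linarith
  define \<sigma> where "\<sigma> = qpoch (- (h powi (int m + 1))) q"
  have [simp]: "\<sigma> x \<noteq> 0" for x by (simp add: \<sigma>_def)
  have r: "Suc (r - 1) = r" "r - 1 \<ge> 1" using assms by auto
  have "(chain (weight_inner m r i) (\<lambda>x. weight_inner m r i (r - 1) x * (\<Sum>y\<in>{L..x}. iq (x - y) * weight_last m y)) (r - 1) has_sum S)
      (PiE {1..r - 1} (\<lambda>_. {L..}))"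
    by (rule chain_peel) (use assms r in \<open>simp_all add: L_def\<close>)
  also have "?this \<longleftrightarrow> (chain (weight m i) (\<lambda>x. weight m i (r - 1) x * pair_sum m (pair_coeff m 0 0) (ext_coeff m 0) x) (r - 1) has_sum S)
     (PiE {1..r - 1} (\<lambda>_. {L..}))"
  proof (rule has_sum_cong)
    fix s assume "s \<in> PiE {1..r - 1} (\<lambda>_. {L..})"
    show "chain (weight_inner m r i) (\<lambda>x. weight_inner m r i (r - 1) x * (\<Sum>y\<in>{L..x}. iq (x - y) * weight_last m y)) (r - 1) s =
       chain (weight m i) (\<lambda>x. weight m i (r - 1) x * pair_sum m (pair_coeff m 0 0) (ext_coeff m 0) x) (r - 1) s"
    proof (rule chain_cong)
      define x where "x = s (r - 1)"
      define c0 where "c0 \<rho> = (- 1) powi \<rho> * h powi (\<rho>\<^sup>2 - \<rho>)" for \<rho>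
      have "(\<Sum>y\<in>{L..x}. iq (x - y) * weight_last m y) =
          (\<Sum>y\<in>{L..x}. iq (x - y) * ((h powi (y\<^sup>2 + int m * y) * \<sigma> y) * pair_sum m c0 (\<lambda>_. 0) y))"
      proof (rule sum.cong[OF refl])
        fix y assume "y \<in> {L..x}"
        then have "pair_sum m c0 (\<lambda>_. 0) y = (- 1) powi y * h powi (y\<^sup>2 - y) * qbinom q (int m + y) (int m + 2 * y)"
          using unit_Bailey_pair[of m y] by (simp add: pair_sum_def c0_def kern_ext_def L_def)
        then show "iq (x - y) * weight_last m y =
          iq (x - y) * ((h powi (y\<^sup>2 + int m * y) * \<sigma> y) * pair_sum m c0 (\<lambda>_. 0) y)"
          by (simp only: weight_last_def \<sigma>_def)
      qed
      also have "\<dots> = pair_sum m (\<lambda>\<rho>. c0 \<rho> * (h powi (\<rho>\<^sup>2 + int m * \<rho>) * \<sigma> x)) (\<lambda>_. 0) x"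
        unfolding \<sigma>_def by (rule pair_sum_transfer) (rule kern_ext_step_qpoch[OF L])
      also have "\<dots> = \<sigma> x * pair_sum m (pair_coeff m 0 0) (ext_coeff m 0) x"
      proof -
        have "c0 \<rho> * (h powi (\<rho>\<^sup>2 + int m * \<rho>) * \<sigma> x) = \<sigma> x * pair_coeff m 0 0 \<rho>" for \<rho>
        proof -
          have "\<rho>\<^sup>2 - \<rho> + (\<rho>\<^sup>2 + int m * \<rho>) = (2 + 2 * int 0 + 2 * int 0) * \<rho>\<^sup>2 +
            (int m - 1 + 2 * int m * int 0 + 2 * (int m - 1) * int 0) * \<rho>"
            by (simp add: algebra_simps)
          then have eq: "h powi (\<rho>\<^sup>2 - \<rho>) * h powi (\<rho>\<^sup>2 + int m * \<rho>) =
            h powi ((2 + 2 * int 0 + 2 * int 0) * \<rho>\<^sup>2 + (int m - 1 + 2 * int m * int 0 + 2 * (int m - 1) * int 0) * \<rho>)"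
            by (simp only: powi_mult)
          show ?thesis
            unfolding c0_def pair_coeff_def eq[symmetric] by (simp only: mult_ac)
        qed
        then show ?thesis
          unfolding pair_sum_def ext_coeff_def by (simp only:) (simp add: sum_distrib_left mult.assoc)
      qed
      finally show "weight_inner m r i (r - 1) (s (r - 1)) * (\<Sum>y\<in>{L..s (r - 1)}. iq (s (r - 1) - y) * weight_last m y) =
         weight m i (r - 1) (s (r - 1)) * pair_sum m (pair_coeff m 0 0) (ext_coeff m 0) (s (r - 1))"
        unfolding x_def[symmetric] by (simp add: weight_inner_def \<sigma>_def[symmetric])
    qed (auto simp: weight_inner_def)
  qed
  finally show ?thesis unfolding L_def .
qed

text \<open>The variables from s_(r-1) down to s_(n+1) are gone. Those with index above i were plain
  steps, \<open>r - 1 - max n i\<close> in number, the others shifted steps; truncated subtraction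
  makes \<open>i - n\<close> equal to 0 as long as n is at least i.\<close>

lemma iterated_peel:
  assumes "r \<ge> 2" and "i \<le> r - 1" and "1 \<le> n" and "n \<le> r - 1"
    and "(chain (weight m i) (\<lambda>x. weight m i (r - 1) x * pair_sum m (pair_coeff m 0 0) (ext_coeff m 0) x) (r - 1) has_sum S)
     (PiE {1..r - 1} (\<lambda>_. {- int (m div 2)..}))"
  shows "(chain (weight m i) (\<lambda>x. weight m i n x * pair_sum m (pair_coeff m (r - 1 - max n i) (i - n)) (ext_coeff m (i - n)) x) n has_sum S)
     (PiE {1..n} (\<lambda>_. {- int (m div 2)..}))"
  using assms(4,3)
proof (induction n rule: inc_induct)
  case base
  then show ?case using assms(2,5) by (simp add: max_def)
next
  case (step n)
  define L where "L = - int (m div 2)"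
  have L: "2 * L \<le> 1 - int m" unfolding L_def by linarith
  have *: "(\<Sum>y\<in>{L..x}. iq (x - y) * (weight m i (Suc n) y *
        pair_sum m (pair_coeff m (r - 1 - max (Suc n) i) (i - Suc n)) (ext_coeff m (i - Suc n)) y)) =
      pair_sum m (pair_coeff m (r - 1 - max n i) (i - n)) (ext_coeff m (i - n)) x" for x
  proof (cases "Suc n \<le> i")
    case True
    \<comment> \<open>Since n is at least 1, the index n + 1 is never the special index 1 with its
      halved exponent.\<close>
    have weight: "weight m i (Suc n) y = h powi (2 * y\<^sup>2 + 2 * (int m - 1) * y)" for y
      using True step.prems by (simp add: weight_def weight_exp_def algebra_simps)
    have n: "max (Suc n) i = i" "max n i = i" "Suc (i - Suc n) = i - n" using True by auto
    show ?thesis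
      unfolding weight pair_sum_transfer[OF kern_ext_step_shifted[OF L]] pair_coeff_Suc2 ext_coeff_Suc n ..
  next
    case False
    have weight: "weight m i (Suc n) y = h powi (2 * y\<^sup>2 + 2 * int m * y)" for y
      using False step.prems by (simp add: weight_def weight_exp_def algebra_simps)
    have n: "i - Suc n = 0" "i - n = 0" "Suc (r - 1 - max (Suc n) i) = r - 1 - max n i"
      using False step.hyps by auto
    have e: "ext_coeff m 0 = (\<lambda>_. 0)" by (simp add: ext_coeff_def fun_eq_iff)
    show ?thesis
      unfolding weight n e pair_sum_transfer[OF kern_ext_step[OF L]] pair_coeff_Suc1 n ..
  qed
  have "(chain (weight m i) (\<lambda>x. weight m i n x * (\<Sum>y\<in>{L..x}. iq (x - y) * (weight m i (Suc n) y *
        pair_sum m (pair_coeff m (r - 1 - max (Suc n) i) (i - Suc n)) (ext_coeff m (i - Suc n)) y))) n has_sum S)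
     (PiE {1..n} (\<lambda>_. {L..}))"
    by (rule chain_peel) (use step in \<open>simp_all add: L_def\<close>)
  then show ?case unfolding * unfolding L_def .
qed

lemma chain_1_has_sum:
  assumes "(chain w b 1 has_sum S) (PiE {1..1} (\<lambda>_. {L..}))"
  shows "(b has_sum S) {L..}"
proof -
  have "bij_betw (\<lambda>x::int. (\<lambda>j\<in>{1..1::nat}. x)) {L..} (PiE {1..1} (\<lambda>_. {L..}))"
    by (rule bij_betwI[of _ _ _ "\<lambda>s. s 1"]) (auto simp: fun_eq_iff PiE_iff extensional_def)
  then have "((\<lambda>x. chain w b 1 (\<lambda>j\<in>{1..1}. x)) has_sum S) {L..}"
    using assms has_sum_reindex_bij_betw by blast
  then show ?thesis by (simp add: chain_def)
qed

end

section \<open>The outermost sum\<close>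

text \<open>Multiplied by 1 + u, the odd powers fill up the exponents 1 to 2i, and the isolated 1
  supplies exponent 0.\<close>

lemma geometric_sum_odd_split:
  fixes u :: complex
  assumes "1 + u \<noteq> 0"
  shows "1 / (1 + u) + u * (\<Sum>l<i. u ^ (2 * l)) = (\<Sum>k=0..2*i. u ^ k) / (1 + u)"
proof (induction i)
  case (Suc i)
  have "1 / (1 + u) + u * (\<Sum>l<Suc i. u ^ (2 * l)) = (1 / (1 + u) + u * (\<Sum>l<i. u ^ (2 * l))) + u * u ^ (2 * i)"
    by (simp add: algebra_simps)
  also have "\<dots> = ((\<Sum>k=0..2*i. u ^ k) + (u * u ^ (2 * i) + u * (u * u ^ (2 * i)))) / (1 + u)"
    unfolding Suc.IH using assms by (simp add: field_simps)
  also have "(\<Sum>k=0..2*i. u ^ k) + (u * u ^ (2 * i) + u * (u * u ^ (2 * i))) = (\<Sum>k=0..2*Suc i. u ^ k)"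
    by (simp add: add.assoc)
  finally show ?case .
qed simp

lemma has_sum_sum_fun:
  fixes f :: "'i \<Rightarrow> 'a \<Rightarrow> 'b :: topological_comm_monoid_add"
  assumes "finite I" and "\<And>l. l \<in> I \<Longrightarrow> (f l has_sum c l) A"
  shows "((\<lambda>x. \<Sum>l\<in>I. f l x) has_sum (\<Sum>l\<in>I. c l)) A"
  using assms by (induction I rule: finite_induct) (auto intro!: has_sum_add)

context nome
begin

text \<open>For i = 0 this is \<open>Bailey_limit'\<close>. For i > 0 the weight of s_1 has an extra
  q^(-s_1): \<open>kern_shift\<close> leaves one part for \<open>Bailey_limit'\<close> and one for
  \<open>Bailey_limit\<close> at \<mu> = m - 1, where both involve the same symbol (-q^(m/2))_(s_1).
  The accumulated even powers of u then join the quotient 1/(1+u).\<close>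

lemma final_kernel_sum:
  assumes "2 * L \<le> 1 - int m"
  shows "((\<lambda>x. weight m i 1 x * kern_ext m (ext_coeff m (i - 1) \<rho>) \<rho> x) has_sum
     (qpoch_inf (- (h powi int m)) q / qpoch_inf q q * (h powi (\<rho>\<^sup>2 + (int m + 1 - (if i = 0 then 0 else 2)) * \<rho>) *
       ((\<Sum>k=0..2*i. (h powi (2 * \<rho> + int m)) ^ k) / (1 + h powi (2 * \<rho> + int m)))))) {L..}"
proof -
  define C where "C = qpoch_inf (- (h powi int m)) q / qpoch_inf q q"
  define u where "u = h powi (2 * \<rho> + int m)"
  have u': "h powi (int m + 2 * \<rho>) = u" by (simp add: u_def add.commute)
  have u1: "1 + u \<noteq> 0" by (simp add: u_def)
  have lim: "((\<lambda>s. h powi (s\<^sup>2 + (int m + 1) * s) * qpoch (- (h powi int m)) q s * kern (int m) \<rho> s) has_sum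
      (C * (h powi (\<rho>\<^sup>2 + (int m + 1) * \<rho>) / (1 + u)))) {L..}"
    using Bailey_limit'[OF assms, of \<rho>] unfolding u' C_def .
  show ?thesis
  proof (cases "i = 0")
    case True
    then show ?thesis
      using lim unfolding C_def u_def by (simp add: weight_def weight_exp_def kern_ext_def ext_coeff_def algebra_simps)
  next
    case False
    define e where "e = ext_coeff m (i - 1) \<rho>"
    have L2: "2 * L \<le> 1 - (int m - 1)" using assms by simp
    have lim2: "((\<lambda>s. h powi (s\<^sup>2 + (int m - 1) * s) * qpoch (- (h powi int m)) q s * kern (int m - 1) (\<rho> + 1) s) has_sum
      (C * h powi ((\<rho> + 1)\<^sup>2 + (int m - 1) * (\<rho> + 1)))) {L..}"
      using Bailey_limit[OF L2, of "\<rho> + 1"] unfolding C_def by simp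
    have "((\<lambda>s. h powi (- 2 * \<rho>) * (h powi (s\<^sup>2 + (int m + 1) * s) * qpoch (- (h powi int m)) q s * kern (int m) \<rho> s) +
        (1 + e) * (h powi (s\<^sup>2 + (int m - 1) * s) * qpoch (- (h powi int m)) q s * kern (int m - 1) (\<rho> + 1) s)) has_sum
       (h powi (- 2 * \<rho>) * (C * (h powi (\<rho>\<^sup>2 + (int m + 1) * \<rho>) / (1 + u))) +
        (1 + e) * (C * h powi ((\<rho> + 1)\<^sup>2 + (int m - 1) * (\<rho> + 1))))) {L..}"
      by (intro has_sum_add has_sum_cmult_right lim lim2)
    moreover have "h powi (- 2 * \<rho>) * (h powi (s\<^sup>2 + (int m + 1) * s) * qpoch (- (h powi int m)) q s * kern (int m) \<rho> s) +
        (1 + e) * (h powi (s\<^sup>2 + (int m - 1) * s) * qpoch (- (h powi int m)) q s * kern (int m - 1) (\<rho> + 1) s) =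
        weight m i 1 s * kern_ext m e \<rho> s" for s
    proof -
      have w: "weight m i 1 s = h powi (s\<^sup>2 + (int m - 1) * s) * qpoch (- (h powi int m)) q s"
        using False by (simp add: weight_def weight_exp_def algebra_simps)
      have e1: "h powi (s\<^sup>2 + (int m - 1) * s) = h powi (s\<^sup>2 + (int m + 1) * s) * h powi (- 2 * s)"
        unfolding powi_mult by (simp add: algebra_simps)
      have alg: "a * (b * g * k) + (1 + e) * (b * t * g * k') = (b * t) * g * (k + e * k')"
        if "t * k = a * k + t * k'" for a b g k t k' :: complex
      proof -
        have "(b * t) * g * (k + e * k') = b * g * (t * k) + b * t * g * (e * k')"
          by (simp add: algebra_simps)
        then show ?thesis unfolding that by (simp add: algebra_simps)
      qed
      show ?thesis
        unfolding w e1 kern_ext_def by (rule alg) (rule kern_shift)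
    qed
    moreover have "h powi (- 2 * \<rho>) * (C * (h powi (\<rho>\<^sup>2 + (int m + 1) * \<rho>) / (1 + u))) +
        (1 + e) * (C * h powi ((\<rho> + 1)\<^sup>2 + (int m - 1) * (\<rho> + 1))) =
       C * (h powi (\<rho>\<^sup>2 + (int m - 1) * \<rho>) * ((\<Sum>k=0..2*i. u ^ k) / (1 + u)))"
    proof -
      define w where "w = h powi (\<rho>\<^sup>2 + (int m - 1) * \<rho>)"
      have e1: "h powi (- 2 * \<rho>) * h powi (\<rho>\<^sup>2 + (int m + 1) * \<rho>) = w"
        unfolding powi_mult w_def by (simp add: algebra_simps)
      have e2: "h powi ((\<rho> + 1)\<^sup>2 + (int m - 1) * (\<rho> + 1)) = w * u"
        unfolding powi_mult w_def u_def by (simp add: algebra_simps power2_eq_square)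
      have ul: "h powi (2 * int l * (2 * \<rho> + int m)) = u ^ (2 * l)" for l
        unfolding u_def power_int_power' by (simp add: mult.commute)
      have "{..<i} = insert 0 {1..i-1}" using False by auto
      then have "(\<Sum>l<i. u ^ (2 * l)) = 1 + e"
        unfolding e_def ext_coeff_def ul by simp
      then have g: "1 / (1 + u) + u * (1 + e) = (\<Sum>k=0..2*i. u ^ k) / (1 + u)"
        using geometric_sum_odd_split[OF u1, of i] by simp
      have "h powi (- 2 * \<rho>) * (C * (h powi (\<rho>\<^sup>2 + (int m + 1) * \<rho>) / (1 + u))) =
          C * (h powi (- 2 * \<rho>) * h powi (\<rho>\<^sup>2 + (int m + 1) * \<rho>)) * (1 / (1 + u))"
        by simp
      then show ?thesis
        unfolding e1 e2 g[symmetric] w_def[symmetric] by (simp add: algebra_simps)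
    qed
    ultimately have "((\<lambda>s. weight m i 1 s * kern_ext m e \<rho> s) has_sum
        (C * (h powi (\<rho>\<^sup>2 + (int m - 1) * \<rho>) * ((\<Sum>k=0..2*i. u ^ k) / (1 + u))))) {L..}"
      by (simp only:)
    then show ?thesis
      using False unfolding C_def u_def e_def by simp
  qed
qed

text \<open>The cases i = 0 and i > 0 differ in the number of shifted steps and in the weight of
  s_1, but give one formula for the exponent.\<close>

lemma pair_coeff_final:
  assumes "r \<ge> 2" and "i \<le> r - 1"
  shows "pair_coeff m (r - 1 - max 1 i) (i - 1) \<rho> * h powi (\<rho>\<^sup>2 + (int m + 1 - (if i = 0 then 0 else 2)) * \<rho>) =
     (- 1) powi \<rho> * h powi ((2 * int r - 1) * \<rho>\<^sup>2 + 2 * ((int r - 1) * int m - int i) * \<rho>)"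
proof -
  have "(2 + 2 * int (r - 1 - max 1 i) + 2 * int (i - 1)) * \<rho>\<^sup>2 +
      (int m - 1 + 2 * int m * int (r - 1 - max 1 i) + 2 * (int m - 1) * int (i - 1)) * \<rho> +
      (\<rho>\<^sup>2 + (int m + 1 - (if i = 0 then 0 else 2)) * \<rho>) =
      (2 * int r - 1) * \<rho>\<^sup>2 + 2 * ((int r - 1) * int m - int i) * \<rho>"
  proof (cases "i = 0")
    case True
    have "int (r - 1 - max 1 i) = int r - 2" using True assms by (simp add: of_nat_diff)
    then show ?thesis using True by (simp add: algebra_simps)
  next
    case False
    have "int (r - 1 - max 1 i) = int r - 1 - int i" "int (i - 1) = int i - 1"
      using False assms by (auto simp: max_def of_nat_diff)
    then show ?thesis using False by (simp add: algebra_simps)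
  qed
  then show ?thesis
    unfolding pair_coeff_def mult.assoc[of "(- 1) powi \<rho>"] powi_mult by simp
qed

lemma pair_coeff_summable: "(\<lambda>\<rho>. norm (pair_coeff m A B \<rho>)) summable_on UNIV"
  using powi_quadratic_summable[of "2 + 2 * int A + 2 * int B" "int m - 1 + 2 * int m * int A + 2 * (int m - 1) * int B" 0]
  by (simp add: pair_coeff_def norm_mult norm_power_int)

text \<open>Each term of \<open>ext_coeff\<close> changes only the linear and constant parts of the
  exponent, so the quadratic decay persists.\<close>

lemma pair_coeff_ext_coeff_summable: "(\<lambda>\<rho>. norm (pair_coeff m A B \<rho> * ext_coeff m D \<rho>)) summable_on UNIV"
proof -
  define a b where "a = 2 + 2 * int A + 2 * int B"
    and "b = int m - 1 + 2 * int m * int A + 2 * (int m - 1) * int B"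
  have "(\<lambda>\<rho>. \<Sum>l=1..D. norm (h powi (a * \<rho>\<^sup>2 + (b + 4 * int l) * \<rho> + 2 * int l * int m))) summable_on UNIV"
    by (intro has_sum_imp_summable[OF has_sum_sum_fun[OF _ has_sum_infsum]] powi_quadratic_summable)
       (simp_all add: a_def)
  then show ?thesis
  proof (rule Infinite_Sum.abs_summable_on_comparison_test')
    fix \<rho>
    have "norm (pair_coeff m A B \<rho> * ext_coeff m D \<rho>) = norm (\<Sum>l=1..D. pair_coeff m A B \<rho> * h powi (2 * int l * (2 * \<rho> + int m)))"
      by (simp add: ext_coeff_def sum_distrib_left)
    also have "\<dots> \<le> (\<Sum>l=1..D. norm (pair_coeff m A B \<rho> * h powi (2 * int l * (2 * \<rho> + int m))))"
      by (rule norm_sum)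
    also have "\<dots> = (\<Sum>l=1..D. norm (h powi (a * \<rho>\<^sup>2 + (b + 4 * int l) * \<rho> + 2 * int l * int m)))"
    proof (rule sum.cong[OF refl])
      fix l
      have "a * \<rho>\<^sup>2 + b * \<rho> + 2 * int l * (2 * \<rho> + int m) = a * \<rho>\<^sup>2 + (b + 4 * int l) * \<rho> + 2 * int l * int m"
        by (simp add: algebra_simps)
      then have "h powi (a * \<rho>\<^sup>2 + b * \<rho>) * h powi (2 * int l * (2 * \<rho> + int m)) =
          h powi (a * \<rho>\<^sup>2 + (b + 4 * int l) * \<rho> + 2 * int l * int m)"
        by (simp only: powi_mult)
      then have "pair_coeff m A B \<rho> * h powi (2 * int l * (2 * \<rho> + int m)) =
          (- 1) powi \<rho> * h powi (a * \<rho>\<^sup>2 + (b + 4 * int l) * \<rho> + 2 * int l * int m)"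
        unfolding pair_coeff_def a_def[symmetric] b_def[symmetric] by (simp only: mult.assoc)
      then show "norm (pair_coeff m A B \<rho> * h powi (2 * int l * (2 * \<rho> + int m))) =
          norm (h powi (a * \<rho>\<^sup>2 + (b + 4 * int l) * \<rho> + 2 * int l * int m))"
        by (simp only: norm_mult norm_power_int) simp
    qed
    finally show "norm (pair_coeff m A B \<rho> * ext_coeff m D \<rho>) \<le>
        (\<Sum>l=1..D. norm (h powi (a * \<rho>\<^sup>2 + (b + 4 * int l) * \<rho> + 2 * int l * int m)))" .
  qed
qed

text \<open>Kernels are uniformly bounded, so the double family is dominated by a product of a
  summable function of x and one of \<rho>.\<close>

lemma pair_sum_interchange:
  assumes S: "((\<lambda>x. weight m i 1 x * pair_sum m (pair_coeff m A B) (ext_coeff m D) x) has_sum S) {L..}"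
    and V: "\<And>\<rho>. ((\<lambda>x. weight m i 1 x * kern_ext m (ext_coeff m D \<rho>) \<rho> x) has_sum V \<rho>) {L..}"
  shows "((\<lambda>\<rho>. pair_coeff m A B \<rho> * V \<rho>) has_sum S) UNIV"
proof -
  define F where "F = (\<lambda>(x, \<rho>). weight m i 1 x * (pair_coeff m A B \<rho> * kern_ext m (ext_coeff m D \<rho>) \<rho> x))"
  obtain K where K: "K > 0" "\<And>k. norm (iq k) \<le> K"
    using iq_bounded by blast
  have kern: "norm (kern \<mu> \<rho> x) \<le> K * K" for \<mu> \<rho> x
    unfolding kern_def norm_mult using K by (intro mult_mono) auto
  have "(\<lambda>x. norm (weight m i 1 x)) summable_on {L..}"
    using weight_summable[of L "\<lambda>_. 1" 1] by simp
  moreover have "(\<lambda>\<rho>. norm (pair_coeff m A B \<rho>) * (K * K) + norm (pair_coeff m A B \<rho> * ext_coeff m D \<rho>) * (K * K)) summable_on UNIV"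
    by (intro summable_on_add summable_on_cmult_left pair_coeff_summable pair_coeff_ext_coeff_summable)
  ultimately have "(\<lambda>(x, \<rho>). norm (weight m i 1 x) * (norm (pair_coeff m A B \<rho>) * (K * K) + norm (pair_coeff m A B \<rho> * ext_coeff m D \<rho>) * (K * K)))
      summable_on ({L..} \<times> UNIV)"
    by (rule summable_on_times_real) (use K in auto)
  then have "(\<lambda>p. norm (F p)) summable_on ({L..} \<times> UNIV)"
  proof (rule Infinite_Sum.abs_summable_on_comparison_test')
    fix p :: "int \<times> int"
    obtain x \<rho> where p: "p = (x, \<rho>)" by force
    have "norm (pair_coeff m A B \<rho> * kern_ext m (ext_coeff m D \<rho>) \<rho> x) =
        norm (pair_coeff m A B \<rho> * kern (int m) \<rho> x + pair_coeff m A B \<rho> * ext_coeff m D \<rho> * kern (int m - 1) (\<rho> + 1) x)"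
      by (simp add: kern_ext_def algebra_simps)
    also have "\<dots> \<le> norm (pair_coeff m A B \<rho> * kern (int m) \<rho> x) + norm (pair_coeff m A B \<rho> * ext_coeff m D \<rho> * kern (int m - 1) (\<rho> + 1) x)"
      by (rule norm_triangle_ineq)
    also have "\<dots> \<le> norm (pair_coeff m A B \<rho>) * (K * K) + norm (pair_coeff m A B \<rho> * ext_coeff m D \<rho>) * (K * K)"
      unfolding norm_mult[of _ "kern _ _ _"] by (intro add_mono mult_left_mono kern) auto
    finally show "norm (F p) \<le> (case p of (x, \<rho>) \<Rightarrow>
        norm (weight m i 1 x) * (norm (pair_coeff m A B \<rho>) * (K * K) + norm (pair_coeff m A B \<rho> * ext_coeff m D \<rho>) * (K * K)))"
      unfolding p F_def by (simp add: norm_mult mult_left_mono)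
  qed
  then have "F summable_on ({L..} \<times> UNIV)"
    by (rule abs_summable_summable)
  then obtain S' where S': "(F has_sum S') ({L..} \<times> UNIV)"
    by (auto simp: summable_on_def)
  have "((\<lambda>x. weight m i 1 x * pair_sum m (pair_coeff m A B) (ext_coeff m D) x) has_sum S') {L..}"
    using S'
  proof (rule has_sum_SigmaD)
    fix x
    have "((\<lambda>\<rho>. pair_coeff m A B \<rho> * kern_ext m (ext_coeff m D \<rho>) \<rho> x) has_sum pair_sum m (pair_coeff m A B) (ext_coeff m D) x) {- x - int m..x}"
      unfolding pair_sum_def by (rule has_sum_finite) simp
    then have "((\<lambda>\<rho>. pair_coeff m A B \<rho> * kern_ext m (ext_coeff m D \<rho>) \<rho> x) has_sum pair_sum m (pair_coeff m A B) (ext_coeff m D) x) UNIV"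
      by (subst has_sum_cong_neutral[of "{- x - int m..x}" _ _ "\<lambda>\<rho>. pair_coeff m A B \<rho> * kern_ext m (ext_coeff m D \<rho>) \<rho> x"])
         (auto simp: kern_ext_eq_0)
    then show "((\<lambda>\<rho>. F (x, \<rho>)) has_sum (weight m i 1 x * pair_sum m (pair_coeff m A B) (ext_coeff m D) x)) UNIV"
      unfolding F_def by (simp add: has_sum_cmult_right)
  qed
  \<comment> \<open>Summing over \<rho> first gives back the series in S, so the total of the double
    family is S and may be evaluated in the other order.\<close>
  then have "S' = S" using S has_sum_unique by blast
  then have "((\<lambda>(\<rho>, x). F (x, \<rho>)) has_sum S) (UNIV \<times> {L..})"
    using S' has_sum_swap by blast
  then show ?thesis
  proof (rule has_sum_SigmaD)
    fix \<rho>
    have "((\<lambda>x. pair_coeff m A B \<rho> * (weight m i 1 x * kern_ext m (ext_coeff m D \<rho>) \<rho> x)) has_sum (pair_coeff m A B \<rho> * V \<rho>)) {L..}"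
      by (intro has_sum_cmult_right V)
    then show "((\<lambda>x. case (\<rho>, x) of (\<rho>, x) \<Rightarrow> F (x, \<rho>)) has_sum (pair_coeff m A B \<rho> * V \<rho>)) {L..}"
      by (simp add: F_def mult_ac)
  qed
qed

lemma summand_has_sum_theta:
  assumes "r \<ge> 2" and "i \<le> r - 1"
  obtains S where "(summand q h m r i has_sum S) (index_set m r)"
    and "((\<lambda>\<rho>. qpoch_inf (- (h powi int m)) q / qpoch_inf q q *
      ((- 1) powi \<rho> * h powi ((2 * int r - 1) * \<rho>\<^sup>2 + 2 * ((int r - 1) * int m - int i) * \<rho>) *
       ((\<Sum>k=0..2*i. (h powi (2 * \<rho> + int m)) ^ k) / (1 + h powi (2 * \<rho> + int m))))) has_sum S) UNIV"
proof -
  define L where "L = - int (m div 2)"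
  have L: "2 * L \<le> 1 - int m" unfolding L_def by linarith
  obtain S where S: "(summand q h m r i has_sum S) (index_set m r)"
    and ch: "(chain (weight_inner m r i) (weight_last m) r has_sum S) (PiE {1..r} (\<lambda>_. {- int (m div 2)..}))"
    using summand_chain_has_sum[OF assms] by blast
  have "(chain (weight m i) (\<lambda>x. weight m i 1 x * pair_sum m (pair_coeff m (r - 1 - max 1 i) (i - 1)) (ext_coeff m (i - 1)) x) 1 has_sum S)
     (PiE {1..1} (\<lambda>_. {L..}))"
    unfolding L_def by (rule iterated_peel[OF assms _ _ first_peel[OF assms(1) ch]]) (use assms in auto)
  then have "((\<lambda>x. weight m i 1 x * pair_sum m (pair_coeff m (r - 1 - max 1 i) (i - 1)) (ext_coeff m (i - 1)) x) has_sum S) {L..}"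
    by (rule chain_1_has_sum)
  from pair_sum_interchange[OF this final_kernel_sum[OF L]]
  have "((\<lambda>\<rho>. pair_coeff m (r - 1 - max 1 i) (i - 1) \<rho> *
      (qpoch_inf (- (h powi int m)) q / qpoch_inf q q * (h powi (\<rho>\<^sup>2 + (int m + 1 - (if i = 0 then 0 else 2)) * \<rho>) *
       ((\<Sum>k=0..2*i. (h powi (2 * \<rho> + int m)) ^ k) / (1 + h powi (2 * \<rho> + int m)))))) has_sum S) UNIV" .
  moreover have "pair_coeff m (r - 1 - max 1 i) (i - 1) \<rho> * (C * (h powi (\<rho>\<^sup>2 + (int m + 1 - (if i = 0 then 0 else 2)) * \<rho>) * X)) =
     C * ((- 1) powi \<rho> * h powi ((2 * int r - 1) * \<rho>\<^sup>2 + 2 * ((int r - 1) * int m - int i) * \<rho>) * X)" for C X \<rho>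
    unfolding pair_coeff_final[OF assms, symmetric] by (simp only: mult_ac)
  ultimately show ?thesis using S that by (simp only:)
qed

end

section \<open>Symmetrisation and theta series\<close>

lemma geometric_sum_alternating:
  fixes u :: complex
  shows "(1 + u) * (\<Sum>l=0..n. (- u) ^ l) = 1 + (- 1) ^ n * u ^ Suc n"
proof (induction n)
  case (Suc n)
  then show ?case by (simp add: algebra_simps power_minus[of u])
qed simp

lemma geometric_sum_reflect:
  fixes u :: complex
  assumes "u \<noteq> 0"
  shows "u ^ n * (\<Sum>k=0..n. (inverse u) ^ k) = (\<Sum>k=0..n. u ^ k)"
proof -
  have "u ^ n * (\<Sum>k=0..n. (inverse u) ^ k) = (\<Sum>k=0..n. u ^ (n - k))"
    unfolding sum_distrib_left using assms
    by (intro sum.cong) (auto simp: power_diff power_inverse divide_inverse)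
  also have "\<dots> = (\<Sum>k=0..n. u ^ k)"
    by (rule sum.reindex_bij_witness[of _ "\<lambda>k. n - k" "\<lambda>k. n - k"]) auto
  finally show ?thesis .
qed

text \<open>Multiply by (1-u)(1+u): the first sum closes up with 1 - u, the alternating one with 1 +
  u, and the remaining 1 - u^(2p+2) is divisible by 1 - u^2.\<close>

lemma geometric_sum_product:
  fixes u :: complex
  assumes "u \<noteq> 1" and "u \<noteq> - 1"
  shows "(\<Sum>k=0..2*i. u ^ k) * (\<Sum>l=0..2*p+1. (- u) ^ l) = (1 - u ^ (2 * i + 1)) * (\<Sum>l=0..p. (u\<^sup>2) ^ l)"
proof -
  have a: "(1 - u) * (\<Sum>k=0..2*i. u ^ k) = 1 - u ^ (2 * i + 1)"
    using one_diff_power_eq[of u "2 * i + 1"] by (simp add: lessThan_Suc_atMost atLeast0AtMost)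
  have b: "(1 + u) * (\<Sum>l=0..2*p+1. (- u) ^ l) = 1 - u ^ (2 * p + 2)"
    unfolding geometric_sum_alternating by simp
  have c: "(1 - u\<^sup>2) * (\<Sum>l=0..p. (u\<^sup>2) ^ l) = 1 - (u\<^sup>2) ^ (p + 1)"
    using one_diff_power_eq[of "u\<^sup>2" "p + 1"] by (simp add: lessThan_Suc_atMost atLeast0AtMost)
  have d: "(u\<^sup>2) ^ (p + 1) = u ^ (2 * p + 2)"
  proof -
    have "2 * p + 2 = 2 * (p + 1)" by simp
    then show ?thesis by (simp only: power_mult)
  qed
  have sq: "1 - u\<^sup>2 = (1 - u) * (1 + u)" by (simp add: algebra_simps power2_eq_square)
  have nz: "(1 - u) * (1 + u) \<noteq> 0"
    using assms by (simp add: add_eq_0_iff)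
  have "((1 - u) * (1 + u)) * ((\<Sum>k=0..2*i. u ^ k) * (\<Sum>l=0..2*p+1. (- u) ^ l)) =
     ((1 - u) * (\<Sum>k=0..2*i. u ^ k)) * ((1 + u) * (\<Sum>l=0..2*p+1. (- u) ^ l))"
    by (simp only: mult_ac)
  also have "\<dots> = (1 - u ^ (2 * i + 1)) * ((1 - u\<^sup>2) * (\<Sum>l=0..p. (u\<^sup>2) ^ l))"
    unfolding a b c d ..
  also have "\<dots> = ((1 - u) * (1 + u)) * ((1 - u ^ (2 * i + 1)) * (\<Sum>l=0..p. (u\<^sup>2) ^ l))"
    unfolding sq by (simp only: mult_ac)
  finally show ?thesis using nz by (simp only: mult_cancel_left) simp
qed

lemma has_sum_int_shift:
  fixes f :: "int \<Rightarrow> complex"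
  assumes "(f has_sum S) UNIV"
  shows "((\<lambda>\<rho>. f (\<rho> - a)) has_sum S) UNIV"
proof -
  have "bij_betw (\<lambda>\<rho>::int. \<rho> - a) UNIV UNIV"
    by (rule bij_betwI[of _ _ _ "\<lambda>\<rho>. \<rho> + a"]) auto
  from has_sum_reindex_bij_betw[OF this, of f] assms show ?thesis by simp
qed

lemma has_sum_int_reflect:
  fixes f :: "int \<Rightarrow> complex"
  assumes "(f has_sum S) UNIV"
  shows "((\<lambda>\<rho>. f (- a - \<rho>)) has_sum S) UNIV"
proof -
  have "bij_betw (\<lambda>\<rho>::int. - a - \<rho>) UNIV UNIV"
    by (rule bij_betwI[of _ _ _ "\<lambda>\<rho>. - a - \<rho>"]) auto
  from has_sum_reindex_bij_betw[OF this, of f] assms show ?thesis by simp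
qed

context nome
begin

section \<open>Theta functions of base q^(2r-1)\<close>

definition theta :: "nat \<Rightarrow> int \<Rightarrow> complex" where
  "theta r x = qpoch_infs [q ^ (2 * r - 1), h powi (2 * int r - 1 + 2 * x), h powi (2 * int r - 1 - 2 * x)] (q ^ (2 * r - 1))"

text \<open>The triple product in base q^R with R = 2r - 1, at the argument q^(r-1/2+x); the half
  power cancels the linear term of \<rho>(\<rho>-1).\<close>

lemma theta_has_sum:
  assumes "r \<ge> 1"
  shows "((\<lambda>\<rho>. (- 1) powi \<rho> * h powi ((2 * int r - 1) * \<rho>\<^sup>2 + 2 * x * \<rho>)) has_sum theta r x) UNIV"
proof -
  define R where "R = 2 * r - 1"
  have R: "int R = 2 * int r - 1" using assms by (simp add: R_def)
  have R0: "R > 0" using assms by (simp add: R_def)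
  interpret N: nome "h ^ R" "q ^ R"
    using norm_h R0 by unfold_locales (auto simp: norm_power power_less_one_iff q_eq power_mult[symmetric] mult.commute)
  define X where "X = h powi (2 * int r - 1 + 2 * x)"
  have "X \<noteq> 0" by (simp add: X_def)
  from N.Jacobi_triple_product[OF this]
  have "((\<lambda>\<rho>. (- 1) powi \<rho> * (h ^ R) powi (\<rho> * (\<rho> - 1)) * X powi \<rho>) has_sum
      (qpoch_inf (q ^ R) (q ^ R) * qpoch_inf X (q ^ R) * qpoch_inf (q ^ R / X) (q ^ R))) UNIV" .
  moreover have "(- 1) powi \<rho> * (h ^ R) powi (\<rho> * (\<rho> - 1)) * X powi \<rho> =
      (- 1) powi \<rho> * h powi ((2 * int r - 1) * \<rho>\<^sup>2 + 2 * x * \<rho>)" for \<rho>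
  proof -
    have "int R * (\<rho> * (\<rho> - 1)) + (2 * int r - 1 + 2 * x) * \<rho> = (2 * int r - 1) * \<rho>\<^sup>2 + 2 * x * \<rho>"
      unfolding R by (simp add: algebra_simps power2_eq_square)
    then show ?thesis
      unfolding X_def power_int_power power_int_mult[symmetric] mult.assoc[of "(- 1) powi \<rho>"] powi_mult by simp
  qed
  moreover have "q ^ R / X = h powi (2 * int r - 1 - 2 * x)"
  proof -
    have "2 * int r - 1 - 2 * x = 2 * int R - (2 * int r - 1 + 2 * x)" by (simp add: R)
    then show ?thesis
      unfolding X_def q_power by (simp only: power_int_diff[OF disjI1[OF h_nonzero]])
  qed
  ultimately show ?thesis
    unfolding theta_def qpoch_infs_def R_def[symmetric] X_def by (simp add: mult.assoc)
qed

text \<open>Replace \<rho> by \<rho> - p in the series. This is the source of the sign and the power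
  of q in front of d_(2p+1).\<close>

lemma theta_quasi_periodic:
  assumes "r \<ge> 1"
  shows "theta r (x + (2 * int r - 1) * int p) = (- 1) ^ p * h powi (- 2 * int p * x - (2 * int r - 1) * (int p)\<^sup>2) * theta r x"
proof -
  define c where "c = (- 1) ^ p * h powi (- 2 * int p * x - (2 * int r - 1) * (int p)\<^sup>2)"
  have "((\<lambda>\<rho>. (- 1) powi (\<rho> - int p) * h powi ((2 * int r - 1) * (\<rho> - int p)\<^sup>2 + 2 * (x + (2 * int r - 1) * int p) * (\<rho> - int p)))
     has_sum theta r (x + (2 * int r - 1) * int p)) UNIV"
    using has_sum_int_shift[OF theta_has_sum[OF assms]] .
  moreover have "(- 1) powi (\<rho> - int p) * h powi ((2 * int r - 1) * (\<rho> - int p)\<^sup>2 + 2 * (x + (2 * int r - 1) * int p) * (\<rho> - int p)) =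
      c * ((- 1) powi \<rho> * h powi ((2 * int r - 1) * \<rho>\<^sup>2 + 2 * x * \<rho>))" for \<rho>
  proof -
    have "(2 * int r - 1) * (\<rho> - int p)\<^sup>2 + 2 * (x + (2 * int r - 1) * int p) * (\<rho> - int p) =
      (- 2 * int p * x - (2 * int r - 1) * (int p)\<^sup>2) + ((2 * int r - 1) * \<rho>\<^sup>2 + 2 * x * \<rho>)"
      by (simp add: algebra_simps power2_eq_square)
    then have "h powi ((2 * int r - 1) * (\<rho> - int p)\<^sup>2 + 2 * (x + (2 * int r - 1) * int p) * (\<rho> - int p)) =
      h powi (- 2 * int p * x - (2 * int r - 1) * (int p)\<^sup>2) * h powi ((2 * int r - 1) * \<rho>\<^sup>2 + 2 * x * \<rho>)"
      by (simp only: powi_mult)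
    moreover have "(- 1 :: complex) powi (\<rho> - int p) = (- 1) ^ p * (- 1) powi \<rho>"
      by (auto simp: power_int_diff power_int_minus_left minus_one_power_iff)
    ultimately show ?thesis unfolding c_def by (simp only: mult_ac)
  qed
  ultimately have "((\<lambda>\<rho>. c * ((- 1) powi \<rho> * h powi ((2 * int r - 1) * \<rho>\<^sup>2 + 2 * x * \<rho>))) has_sum
      theta r (x + (2 * int r - 1) * int p)) UNIV"
    by (simp only:)
  moreover have "((\<lambda>\<rho>. c * ((- 1) powi \<rho> * h powi ((2 * int r - 1) * \<rho>\<^sup>2 + 2 * x * \<rho>))) has_sum (c * theta r x)) UNIV"
    by (intro has_sum_cmult_right theta_has_sum assms)
  ultimately show ?thesis unfolding c_def using has_sum_unique by blast
qed

text \<open>Of the factor u^(m+2i), the part u^(2i) reverses the geometric sum in 1/u; the part u^m,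
  with the u gained from 1/(1 + 1/u), supplies the numerator u^(m+1).\<close>

lemma theta_reflection:
  fixes r i m :: nat
  defines "\<phi> \<equiv> \<lambda>\<rho>. (- 1) powi \<rho> * h powi ((2 * int r - 1) * \<rho>\<^sup>2 + 2 * ((int r - 1) * int m - int i) * \<rho>)"
  shows "\<phi> (- int m - \<rho>) = (- 1) ^ m * \<phi> \<rho> * (h powi (2 * \<rho> + int m)) ^ (m + 2 * i)"
proof -
  have "(2 * int r - 1) * (- int m - \<rho>)\<^sup>2 + 2 * ((int r - 1) * int m - int i) * (- int m - \<rho>) =
    ((2 * int r - 1) * \<rho>\<^sup>2 + 2 * ((int r - 1) * int m - int i) * \<rho>) + (2 * \<rho> + int m) * int (m + 2 * i)"
    by (simp add: algebra_simps power2_eq_square)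
  then have "h powi ((2 * int r - 1) * (- int m - \<rho>)\<^sup>2 + 2 * ((int r - 1) * int m - int i) * (- int m - \<rho>)) =
     h powi ((2 * int r - 1) * \<rho>\<^sup>2 + 2 * ((int r - 1) * int m - int i) * \<rho>) * (h powi (2 * \<rho> + int m)) ^ (m + 2 * i)"
    by (simp only: powi_mult power_int_power')
  moreover have "(- 1 :: complex) powi (- int m - \<rho>) = (- 1) ^ m * (- 1) powi \<rho>"
    by (auto simp: power_int_minus_left minus_one_power_iff)
  ultimately show ?thesis unfolding \<phi>_def by (simp only: mult_ac)
qed

text \<open>A power u^k only moves the linear coefficient of the exponent, at the cost of
  q^(km/2).\<close>

lemma theta_has_sum_power:
  assumes "r \<ge> 1"
  shows "((\<lambda>\<rho>. (- 1) powi \<rho> * h powi ((2 * int r - 1) * \<rho>\<^sup>2 + 2 * y * \<rho>) * (h powi (2 * \<rho> + int m)) ^ k) has_sum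
     (h powi (int k * int m) * theta r (y + int k))) UNIV"
proof -
  have "((\<lambda>\<rho>. h powi (int k * int m) * ((- 1) powi \<rho> * h powi ((2 * int r - 1) * \<rho>\<^sup>2 + 2 * (y + int k) * \<rho>))) has_sum
     (h powi (int k * int m) * theta r (y + int k))) UNIV"
    by (intro has_sum_cmult_right theta_has_sum assms)
  moreover have "h powi (int k * int m) * ((- 1) powi \<rho> * h powi ((2 * int r - 1) * \<rho>\<^sup>2 + 2 * (y + int k) * \<rho>)) =
     (- 1) powi \<rho> * h powi ((2 * int r - 1) * \<rho>\<^sup>2 + 2 * y * \<rho>) * (h powi (2 * \<rho> + int m)) ^ k" for \<rho>
  proof -
    have "int k * int m + ((2 * int r - 1) * \<rho>\<^sup>2 + 2 * (y + int k) * \<rho>) =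
        ((2 * int r - 1) * \<rho>\<^sup>2 + 2 * y * \<rho>) + (2 * \<rho> + int m) * int k"
      by (simp add: algebra_simps)
    then have "h powi (int k * int m) * h powi ((2 * int r - 1) * \<rho>\<^sup>2 + 2 * (y + int k) * \<rho>) =
        h powi ((2 * int r - 1) * \<rho>\<^sup>2 + 2 * y * \<rho>) * (h powi (2 * \<rho> + int m)) ^ k"
      by (simp only: powi_mult power_int_power')
    then show ?thesis by (simp add: mult.left_commute mult.assoc)
  qed
  ultimately show ?thesis by (simp only:)
qed

lemma summand_has_sum:
  assumes "r \<ge> 2" and "i \<le> r - 1"
  shows "(summand q h m r i has_sum d q h r i m) (index_set m r)"
proof -
  define C where "C = qpoch_inf (- (h powi int m)) q / qpoch_inf q q"
  define y where "y = (int r - 1) * int m - int i"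
  define \<phi> where "\<phi> \<rho> = (- 1) powi \<rho> * h powi ((2 * int r - 1) * \<rho>\<^sup>2 + 2 * y * \<rho>)" for \<rho>
  define u where "u \<rho> = h powi (2 * \<rho> + int m)" for \<rho>
  have r1: "r \<ge> 1" using assms by simp
  have u0: "u \<rho> \<noteq> 0" and u1: "1 + u \<rho> \<noteq> 0" for \<rho> by (simp_all add: u_def)
  have refl_\<phi>: "\<phi> (- int m - \<rho>) = (- 1) ^ m * \<phi> \<rho> * u \<rho> ^ (m + 2 * i)" for \<rho>
    unfolding \<phi>_def u_def y_def by (rule theta_reflection)
  have refl_u: "u (- int m - \<rho>) = inverse (u \<rho>)" for \<rho>
  proof -
    have "2 * (- int m - \<rho>) + int m = - (2 * \<rho> + int m)" by simp
    then show ?thesis unfolding u_def by (simp only: power_int_minus)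
  qed
  have pow: "((\<lambda>\<rho>. \<phi> \<rho> * u \<rho> ^ k) has_sum (h powi (int k * int m) * theta r (y + int k))) UNIV" for k
    unfolding \<phi>_def u_def by (rule theta_has_sum_power[OF r1])
  obtain S where S: "(summand q h m r i has_sum S) (index_set m r)"
    and T: "((\<lambda>\<rho>. C * (\<phi> \<rho> * ((\<Sum>k=0..2*i. u \<rho> ^ k) / (1 + u \<rho>)))) has_sum S) UNIV"
    using summand_has_sum_theta[OF assms, of m] unfolding C_def \<phi>_def u_def y_def by blast
  \<comment> \<open>A term plus its reflection has numerator 1 + (-1)^m u^(m+1), which 1 + u
    divides.\<close>
  have G: "C * (\<phi> \<rho> * ((\<Sum>k=0..2*i. u \<rho> ^ k) / (1 + u \<rho>))) +
      C * (\<phi> (- int m - \<rho>) * ((\<Sum>k=0..2*i. u (- int m - \<rho>) ^ k) / (1 + u (- int m - \<rho>)))) =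
      C * (\<phi> \<rho> * ((\<Sum>k=0..2*i. u \<rho> ^ k) * (\<Sum>l=0..m. (- u \<rho>) ^ l)))" for \<rho>
  proof -
    define v g where "v = u \<rho>" and "g = (\<Sum>k=0..2*i. v ^ k)"
    have v: "v \<noteq> 0" "1 + v \<noteq> 0" using u0 u1 by (simp_all add: v_def)
    have "\<phi> (- int m - \<rho>) * ((\<Sum>k=0..2*i. u (- int m - \<rho>) ^ k) / (1 + u (- int m - \<rho>))) =
       (- 1) ^ m * \<phi> \<rho> * v ^ m * ((v ^ (2 * i) * (\<Sum>k=0..2*i. (inverse v) ^ k)) / (1 + inverse v))"
      unfolding refl_\<phi> refl_u v_def[symmetric] by (simp add: power_add)
    also have "\<dots> = (- 1) ^ m * \<phi> \<rho> * v ^ m * (g / (1 + inverse v))"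
      unfolding geometric_sum_reflect[OF v(1)] g_def ..
    also have "g / (1 + inverse v) = v * g / (1 + v)"
      using v by (simp add: field_simps)
    finally have "C * (\<phi> \<rho> * (g / (1 + v))) + C * (\<phi> (- int m - \<rho>) * ((\<Sum>k=0..2*i. u (- int m - \<rho>) ^ k) / (1 + u (- int m - \<rho>)))) =
      C * (\<phi> \<rho> * (g * ((1 + (- 1) ^ m * v ^ Suc m) / (1 + v))))"
      by (simp add: add_divide_distrib ring_distribs mult_ac)
    also have "(1 + (- 1) ^ m * v ^ Suc m) / (1 + v) = (\<Sum>l=0..m. (- v) ^ l)"
      using geometric_sum_alternating[of v m] v(2) by (metis nonzero_mult_div_cancel_left)
    finally show ?thesis unfolding g_def v_def .
  qed
  have T2: "((\<lambda>\<rho>. C * (\<phi> \<rho> * ((\<Sum>k=0..2*i. u \<rho> ^ k) * (\<Sum>l=0..m. (- u \<rho>) ^ l)))) has_sum (S + S)) UNIV"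
    using has_sum_add[OF T has_sum_int_reflect[OF T, of "int m"]] unfolding G .
  have "S = d q h r i m"
  proof (cases "even m")
    case True
    define p where "p = m div 2"
    have m: "m = 2 * p" using True by (simp add: p_def)
    have "((\<lambda>\<rho>. C * (\<Sum>k=0..2*i. \<Sum>l=0..m. (- 1) ^ l * (\<phi> \<rho> * u \<rho> ^ (k + l)))) has_sum
        (C * (\<Sum>k=0..2*i. \<Sum>l=0..m. (- 1) ^ l * (h powi (int (k + l) * int m) * theta r (y + int (k + l)))))) UNIV"
      by (intro has_sum_cmult_right has_sum_sum_fun pow) auto
    moreover have "C * (\<phi> \<rho> * ((\<Sum>k=0..2*i. u \<rho> ^ k) * (\<Sum>l=0..m. (- u \<rho>) ^ l))) =
        C * (\<Sum>k=0..2*i. \<Sum>l=0..m. (- 1) ^ l * (\<phi> \<rho> * u \<rho> ^ (k + l)))" for \<rho>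
      unfolding sum_product by (simp add: sum_distrib_left power_add power_minus[of "u \<rho>"] mult_ac)
    ultimately have "S + S = C * (\<Sum>k=0..2*i. \<Sum>l=0..m. (- 1) ^ l * (h powi (int (k + l) * int m) * theta r (y + int (k + l))))"
      using T2 has_sum_unique by (simp only:) blast
    also have "\<dots> = 2 * d_even q h r i p"
    proof -
      have C: "C = qpoch_inf (- (q ^ p)) q / qpoch_inf q q"
        unfolding C_def m q_power by simp
      have t: "h powi (int (k + l) * int m) * theta r (y + int (k + l)) = q ^ (p * k + p * l) *
        qpoch_infs
          [q ^ (2 * r - 1),
           h powi (2 * (2 * int p * int r + int r - int i - 2 * int p + int k + int l) - 1),
           h powi (2 * (int r + int i + 2 * int p - 2 * int p * int r - int k - int l) - 1)]
          (q ^ (2 * r - 1))" for k l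
      proof -
        have "int (k + l) * int m = 2 * int (p * k + p * l)" unfolding m by (simp add: algebra_simps)
        moreover have "2 * int r - 1 + 2 * (y + int (k + l)) = 2 * (2 * int p * int r + int r - int i - 2 * int p + int k + int l) - 1"
          unfolding y_def m by (simp add: algebra_simps)
        moreover have "2 * int r - 1 - 2 * (y + int (k + l)) = 2 * (int r + int i + 2 * int p - 2 * int p * int r - int k - int l) - 1"
          unfolding y_def m by (simp add: algebra_simps)
        ultimately show ?thesis unfolding theta_def q_power by (simp only:)
      qed
      show ?thesis unfolding t C d_even_def unfolding m by (simp add: mult.assoc)
    qed
    finally have "S = d_even q h r i p" by simp
    then show ?thesis using True by (simp add: d_def p_def)
  next
    case False
    define p where "p = m div 2"
    have m: "m = 2 * p + 1" using False by (simp add: p_def)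
    \<comment> \<open>V collects the contribution of the 1 in 1 - u^(2i+1); the contribution of
      -u^(2i+1) will be its reflection, so 2V = 2S.\<close>
    define V where "V = C * (\<Sum>l=0..p. h powi (int (2 * l) * int m) * theta r (y + int (2 * l)))"
    have V: "((\<lambda>\<rho>. C * (\<Sum>l=0..p. \<phi> \<rho> * u \<rho> ^ (2 * l))) has_sum V) UNIV"
      unfolding V_def by (intro has_sum_cmult_right has_sum_sum_fun pow) auto
    have "C * (\<Sum>l=0..p. \<phi> \<rho> * u \<rho> ^ (2 * l)) + C * (\<Sum>l=0..p. \<phi> (- int m - \<rho>) * u (- int m - \<rho>) ^ (2 * l)) =
       C * (\<phi> \<rho> * ((\<Sum>k=0..2*i. u \<rho> ^ k) * (\<Sum>l=0..m. (- u \<rho>) ^ l)))" for \<rho>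
    proof -
      define v g where "v = u \<rho>" and "g = (\<Sum>l=0..p. (v\<^sup>2) ^ l)"
      have v0: "v \<noteq> 0" "v\<^sup>2 \<noteq> 0" using u0 by (simp_all add: v_def)
      \<comment> \<open>Oddness of m excludes u = 1, as division by 1 - u requires.\<close>
      have "2 * \<rho> + int m \<noteq> 0" unfolding m by presburger
      then have "v \<noteq> 1" by (simp add: v_def u_def)
      have "v \<noteq> - 1" using u1[of \<rho>] by (auto simp: v_def)
      have "(\<Sum>l=0..p. \<phi> (- int m - \<rho>) * u (- int m - \<rho>) ^ (2 * l)) =
         - \<phi> \<rho> * v ^ (2 * i + 1) * ((v\<^sup>2) ^ p * (\<Sum>l=0..p. (inverse (v\<^sup>2)) ^ l))"
        unfolding refl_\<phi> refl_u v_def[symmetric] sum_distrib_left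
        unfolding m by (intro sum.cong refl) (simp add: power_add power_inverse mult_ac flip: power_mult)
      also have "\<dots> = - \<phi> \<rho> * v ^ (2 * i + 1) * g"
        unfolding geometric_sum_reflect[OF v0(2)] g_def ..
      finally have 1: "(\<Sum>l=0..p. \<phi> (- int m - \<rho>) * u (- int m - \<rho>) ^ (2 * l)) = - \<phi> \<rho> * v ^ (2 * i + 1) * g" .
      have 2: "(\<Sum>l=0..p. \<phi> \<rho> * u \<rho> ^ (2 * l)) = \<phi> \<rho> * g"
        unfolding g_def v_def sum_distrib_left by (simp add: power_mult)
      have 3: "(\<Sum>k=0..2*i. v ^ k) * (\<Sum>l=0..m. (- v) ^ l) = (1 - v ^ (2 * i + 1)) * g"
        unfolding m g_def by (rule geometric_sum_product[OF \<open>v \<noteq> 1\<close> \<open>v \<noteq> - 1\<close>])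
      show ?thesis
        unfolding 1 2 unfolding v_def[symmetric] 3 by (simp add: algebra_simps)
    qed
    then have "((\<lambda>\<rho>. C * (\<phi> \<rho> * ((\<Sum>k=0..2*i. u \<rho> ^ k) * (\<Sum>l=0..m. (- u \<rho>) ^ l)))) has_sum (V + V)) UNIV"
      using has_sum_add[OF V has_sum_int_reflect[OF V, of "int m"]] by simp
    then have "V + V = S + S"
      using T2 has_sum_unique by blast
    then have "S = V" by simp
    also have "V = d_odd q h r i p"
    proof -
      \<comment> \<open>X l is y + 2l less p periods of length 2r - 1, which brings the theta
        arguments to the form in \<open>d_odd\<close>.\<close>
      define X where "X l = int r - 1 - int i - int p + 2 * int l" for l
      define c where "c = (- 1) ^ p * h powi ((3 - 2 * int r) * (int p)\<^sup>2 + 2 * (1 + int i - int r) * int p)"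
      have t: "h powi (int (2 * l) * int m) * theta r (y + int (2 * l)) = c * (q ^ l * theta r (X l))" for l
      proof -
        have y: "y + int (2 * l) = X l + (2 * int r - 1) * int p"
          unfolding y_def m X_def by (simp add: algebra_simps)
        have e: "int (2 * l) * int m + (- 2 * int p * X l - (2 * int r - 1) * (int p)\<^sup>2) =
           ((3 - 2 * int r) * (int p)\<^sup>2 + 2 * (1 + int i - int r) * int p) + 2 * int l"
          unfolding m X_def by (simp add: algebra_simps power2_eq_square)
        have "h powi (int (2 * l) * int m) * h powi (- 2 * int p * X l - (2 * int r - 1) * (int p)\<^sup>2) =
           h powi ((3 - 2 * int r) * (int p)\<^sup>2 + 2 * (1 + int i - int r) * int p) * h powi (2 * int l)"
          by (simp only: powi_mult e)
        then have "h powi (int (2 * l) * int m) * h powi (- 2 * int p * X l - (2 * int r - 1) * (int p)\<^sup>2) * ((- 1) ^ p * theta r (X l)) =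
           h powi ((3 - 2 * int r) * (int p)\<^sup>2 + 2 * (1 + int i - int r) * int p) * h powi (2 * int l) * ((- 1) ^ p * theta r (X l))"
          by (simp only:)
        then show ?thesis
          unfolding y theta_quasi_periodic[OF r1] c_def q_power by (simp only: mult_ac)
      qed
      have C: "C = qpoch_inf (- (h ^ (2 * p + 1))) q / qpoch_inf q q"
        unfolding C_def m by (simp only: power_int_of_nat)
      have th: "theta r (X l) = qpoch_infs
          [q ^ (2 * r - 1),
           h powi (2 * (2 * int r - int i - int p + 2 * int l) - 3),
           h powi (2 * (int i + int p - 2 * int l) + 1)]
          (q ^ (2 * r - 1))" for l
      proof -
        have "2 * int r - 1 + 2 * X l = 2 * (2 * int r - int i - int p + 2 * int l) - 3"
          "2 * int r - 1 - 2 * X l = 2 * (int i + int p - 2 * int l) + 1"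
          by (simp_all add: X_def)
        then show ?thesis unfolding theta_def by (simp only:)
      qed
      show ?thesis
        unfolding V_def t d_odd_def c_def[symmetric] C[symmetric] th[symmetric] sum_distrib_left[symmetric] by simp
    qed
    finally show ?thesis using False by (simp add: d_def p_def)
  qed
  then show ?thesis using S by simp
qed

end

theorem theorem2p11:
  fixes q h :: complex and m r i :: nat
  assumes "q \<noteq> 0" and "norm q < 1" and "h\<^sup>2 = q"
    and "r \<ge> 2" and "i \<le> r - 1"
  shows "(summand q h m r i has_sum d q h r i m) (index_set m r)"
proof -
  have "norm h < 1"
    using assms(2,3) by (metis norm_power norm_ge_zero one_le_power linorder_not_less)
  then interpret nome h q
    using assms by unfold_locales auto
  show ?thesis using assms by (intro summand_has_sum)
qed

end
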